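(* Let $G=(V,E)$ be a connected graph. Then $\mathcal{H}_3(G)$ is Mengerian if and only if $|V|=4$, or $G=C_8$ (the cycle on $8$ vertices), or $G$ is a path with double stars, or $G$ is a star with an additional edge between two of its leaves.
   Context: All graphs are finite, simple and undirected; as a standing assumption $|V|\ge 4$. For a graph $G$, $\mathcal{H}_3(G)$ is the $4$-uniform hypergraph on $V(G)$ whose hyperedges are the $4$-element subsets of $V(G)$ that contain a path of length $3$ in $G$ (the vertices can be ordered $v_1,\dots,v_4$ with $\{v_i,v_{i+1}\}\in E(G)$ for $i=1,2,3$). A tree $T$ is a path with double stars if at most two vertices of $T$ are adjacent to leaves (this includes stars and paths). A star with an additional edge between two of its leaves is $K_{1,n}$ with one extra edge joining two of its leaves. A clutter with incidence matrix $A$ on $n$ vertices is Mengerian if for every $c\in\mathbb{Z}_{\ge0}^n$, $\min\{\langle c,x\rangle: x\ge0 \text{ integral}, Ax\ge\mathbf 1\}=\max\{\langle y,\mathbf 1\rangle : y\ge 0\text{ integral}, y^\top A\le c^\top\}$ (equivalently, its edge ideal is normally torsion-free); the empty clutter is Mengerian. *)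

theory Defs
  imports "Graph_Theory.Graph_Theory"
begin

text \<open>A finite simple undirected graph is a \<^term>\<open>pair_graph\<close>: a finite, loop-free digraph with a
  symmetric arc set, so that the edge \<open>{u, v}\<close> is the pair of arcs \<open>(u, v)\<close>, \<open>(v, u)\<close>.\<close>

definition H3 :: "'a pair_pre_digraph \<Rightarrow> 'a set set" where
  "H3 G = {e. e \<subseteq> pverts G \<and> card e = 4 \<and>
              (\<exists>p. vpath p (with_proj G) \<and> vwalk_length p = 3 \<and> set p \<subseteq> e)}"

text \<open>The library's \<open>forest\<close> and \<open>tree\<close> are directed notions: in a symmetric digraph every edge
  is already a directed cycle of length 2. Cycles of an undirected graph have length at least 3.\<close>

definition undirected_tree :: "'a pair_pre_digraph \<Rightarrow> bool" where
  "undirected_tree G \<longleftrightarrow> pair_graph G \<and> Digraph_Component.connected (with_proj G) \<and>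
     \<not> (\<exists>p. pre_digraph.cycle (with_proj G) p \<and> length p \<ge> 3)"

definition leaf :: "'a pair_pre_digraph \<Rightarrow> 'a \<Rightarrow> bool" where
  "leaf G v \<longleftrightarrow> v \<in> pverts G \<and> out_degree (with_proj G) v = 1"

definition path_with_double_stars :: "'a pair_pre_digraph \<Rightarrow> bool" where
  "path_with_double_stars G \<longleftrightarrow> undirected_tree G \<and>
     card {v \<in> pverts G. \<exists>l. leaf G l \<and> (v, l) \<in> parcs G} \<le> 2"

definition star_with_extra_edge :: "'a pair_pre_digraph \<Rightarrow> bool" where
  "star_with_extra_edge G \<longleftrightarrow>
     (\<exists>S n a b. complete_bipartite_digraph 1 n (with_proj S) \<and>
        leaf S a \<and> leaf S b \<and> a \<noteq> b \<and> (a, b) \<notin> parcs S \<and>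
        pverts G = pverts S \<and> parcs G = parcs S \<union> {(a, b), (b, a)})"

definition cycle_graph :: "nat \<Rightarrow> nat pair_pre_digraph" where
  "cycle_graph n = \<lparr> pverts = {..<n},
     parcs = {(i, j). i < n \<and> j < n \<and> (j = Suc i mod n \<or> i = Suc j mod n)} \<rparr>"

text \<open>Rows of the incidence matrix are indexed by the hyperedges, columns by the vertices;
  nonnegative integral vectors are functions into \<^typ>\<open>nat\<close>.\<close>

definition incidence :: "'a set \<Rightarrow> 'a \<Rightarrow> nat" where
  "incidence e v = (if v \<in> e then 1 else 0)"

definition integral_cover :: "'a set \<Rightarrow> 'a set set \<Rightarrow> ('a \<Rightarrow> nat) \<Rightarrow> bool" where
  "integral_cover V F x \<longleftrightarrow> (\<forall>e\<in>F. (\<Sum>v\<in>V. incidence e v * x v) \<ge> 1)"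

definition integral_packing ::
    "'a set \<Rightarrow> 'a set set \<Rightarrow> ('a \<Rightarrow> nat) \<Rightarrow> ('a set \<Rightarrow> nat) \<Rightarrow> bool" where
  "integral_packing V F c y \<longleftrightarrow> (\<forall>v\<in>V. (\<Sum>e\<in>F. y e * incidence e v) \<le> c v)"

definition mengerian :: "'a set \<Rightarrow> 'a set set \<Rightarrow> bool" where
  "mengerian V F \<longleftrightarrow>
     (\<forall>c :: 'a \<Rightarrow> nat. \<exists>x y.
        is_arg_min (\<lambda>x. \<Sum>v\<in>V. c v * x v) (integral_cover V F) x \<and>
        is_arg_max (\<lambda>y. \<Sum>e\<in>F. y e) (integral_packing V F c) y \<and>
        (\<Sum>v\<in>V. c v * x v) = (\<Sum>e\<in>F. y e))"

end

theory Submission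
  imports Defs
begin

text \<open>In a path with double stars, in a star with an extra edge and in a graph on four vertices the
  hyperedges are the transversals of four consecutive layers of the vertex set. For these and for the
  windows of the eight-cycle a maximum packing is built one edge at a time: while hitting sets have
  positive weight, there is an edge whose removal lowers their minimum weight by only one.

  Conversely, Mengerian clutters are closed under minors, and a clutter on \<open>n\<close> cyclically ordered
  vertices whose edges are the \<open>n\<close> intervals of length \<open>k\<close> is not Mengerian unless \<open>k\<close> divides \<open>n\<close>:
  covers have weight at least \<open>n / k\<close> and packings at most \<open>n / k\<close> edges. Five vertices of which three
  four-subsets are hyperedges have a triangle as a minor; this excludes four-cycles and leaves only the
  stars with an extra edge among the graphs with a triangle. An induced cycle of length \<open>n \<ge> 5\<close> gives the
  obstruction with \<open>k = 4\<close> if \<open>n\<close> is not divisible by 4, and an odd cycle as a minor if it is and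
  \<open>n \<ge> 12\<close>. A vertex attached to the middle of an induced path on five vertices again gives a triangle;
  this excludes proper supergraphs of the eight-cycle, and trees with three vertices adjacent to
  leaves.\<close>

subsection \<open>Covers and packings\<close>

lemma weak_duality:
  assumes cover: "integral_cover V F x" and packing: "integral_packing V F c y"
  shows "(\<Sum>e\<in>F. y e) \<le> (\<Sum>v\<in>V. c v * x v)"
proof -
  have "(\<Sum>e\<in>F. y e) \<le> (\<Sum>e\<in>F. y e * (\<Sum>v\<in>V. incidence e v * x v))"
    using cover by (intro sum_mono) (auto simp: integral_cover_def)
  also have "\<dots> = (\<Sum>v\<in>V. (\<Sum>e\<in>F. y e * incidence e v) * x v)"
    by (simp add: sum_distrib_left sum_distrib_right mult.assoc) (rule sum.swap)
  also have "\<dots> \<le> (\<Sum>v\<in>V. c v * x v)"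
    using packing by (intro sum_mono mult_right_mono) (auto simp: integral_packing_def)
  finally show ?thesis .
qed

lemma mengerianI:
  assumes "\<And>c. \<exists>x y. integral_cover V F x \<and> integral_packing V F c y \<and>
                 (\<Sum>v\<in>V. c v * x v) \<le> (\<Sum>e\<in>F. y e)"
  shows "mengerian V F"
  unfolding mengerian_def
proof
  fix c
  obtain x y where cover: "integral_cover V F x" and packing: "integral_packing V F c y"
    and le: "(\<Sum>v\<in>V. c v * x v) \<le> (\<Sum>e\<in>F. y e)"
    using assms by blast
  have "(\<Sum>v\<in>V. c v * x v) \<le> (\<Sum>v\<in>V. c v * x' v)" if "integral_cover V F x'" for x'
    using le weak_duality[OF that packing] by linarith
  moreover have "(\<Sum>e\<in>F. y' e) \<le> (\<Sum>e\<in>F. y e)" if "integral_packing V F c y'" for y'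
    using le weak_duality[OF cover that] weak_duality[OF cover packing] by linarith
  moreover have "(\<Sum>v\<in>V. c v * x v) = (\<Sum>e\<in>F. y e)"
    using le weak_duality[OF cover packing] by linarith
  ultimately show "\<exists>x y. is_arg_min (\<lambda>x. \<Sum>v\<in>V. c v * x v) (integral_cover V F) x \<and>
        is_arg_max (\<lambda>y. \<Sum>e\<in>F. y e) (integral_packing V F c) y \<and>
        (\<Sum>v\<in>V. c v * x v) = (\<Sum>e\<in>F. y e)"
    using cover packing
    by (intro exI[of _ x] exI[of _ y]) (auto simp: is_arg_min_def is_arg_max_def not_less)
qed

lemma mengerianE:
  assumes "mengerian V F"
  obtains x y where "integral_cover V F x" "integral_packing V F c y"
    "(\<Sum>v\<in>V. c v * x v) = (\<Sum>e\<in>F. y e)"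
  using assms unfolding mengerian_def is_arg_min_def is_arg_max_def by metis

definition hitting_set :: "'a set \<Rightarrow> 'a set set \<Rightarrow> 'a set \<Rightarrow> bool" where
  "hitting_set V F X \<longleftrightarrow> X \<subseteq> V \<and> (\<forall>e\<in>F. e \<inter> X \<noteq> {})"

lemma integral_cover_hitting_set:
  assumes "finite V" "hitting_set V F X"
  shows "integral_cover V F (\<lambda>v. of_bool (v \<in> X))"
  unfolding integral_cover_def
proof
  fix e assume "e \<in> F"
  then obtain v where v: "v \<in> e" "v \<in> X" "v \<in> V" using assms(2) unfolding hitting_set_def by blast
  then have "1 \<le> incidence e v * of_bool (v \<in> X)" by (simp add: incidence_def)
  also have "\<dots> \<le> (\<Sum>v\<in>V. incidence e v * of_bool (v \<in> X))"
    using v assms(1) by (intro member_le_sum) auto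
  finally show "1 \<le> (\<Sum>v\<in>V. incidence e v * of_bool (v \<in> X))" .
qed

lemma sum_mult_hitting_set:
  fixes c :: "'a \<Rightarrow> nat"
  assumes "finite V" "hitting_set V F X"
  shows "(\<Sum>v\<in>V. c v * of_bool (v \<in> X)) = sum c X"
  using assms by (simp add: hitting_set_def Int_absorb1)

lemma integral_packing_add_edge:
  assumes "finite F" "e \<in> F" and pos: "\<And>v. v \<in> e \<Longrightarrow> 0 < c v"
    and packing: "integral_packing V F (\<lambda>v. c v - incidence e v) y"
  shows "integral_packing V F c (y(e := Suc (y e)))"
  unfolding integral_packing_def
proof
  fix v assume "v \<in> V"
  have "(\<Sum>f\<in>F. (y(e := Suc (y e))) f * incidence f v)
      = incidence e v + (\<Sum>f\<in>F. y f * incidence f v)"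
    using assms(1,2) by (simp add: sum.remove[of F e])
  also have "\<dots> \<le> incidence e v + (c v - incidence e v)"
    using packing \<open>v \<in> V\<close> by (simp add: integral_packing_def)
  also have "\<dots> = c v"
    using pos[of v] by (auto simp: incidence_def)
  finally show "(\<Sum>f\<in>F. (y(e := Suc (y e))) f * incidence f v) \<le> c v" .
qed

lemma sum_eq_sum_diff_incidence:
  assumes "finite X" and pos: "\<And>v. v \<in> e \<Longrightarrow> 0 < c v"
  shows "sum c X = (\<Sum>v\<in>X. c v - incidence e v) + card (e \<inter> X)"
proof -
  have "sum c X = (\<Sum>v\<in>X. (c v - incidence e v) + of_bool (v \<in> e))"
    using pos by (intro sum.cong) (force simp: incidence_def)+
  then show ?thesis
    using assms(1) by (simp add: sum.distrib Int_commute)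
qed

definition peelable :: "'a set \<Rightarrow> 'a set set \<Rightarrow> bool" where
  "peelable V F \<longleftrightarrow> (\<forall>(c :: 'a \<Rightarrow> nat) t. (\<forall>X. hitting_set V F X \<longrightarrow> t < sum c X) \<longrightarrow>
    (\<exists>e\<in>F. (\<forall>v\<in>e. 0 < c v) \<and>
      (\<forall>X. hitting_set V F X \<longrightarrow> t \<le> (\<Sum>v\<in>X. c v - incidence e v))))"

lemma peelable_packing:
  fixes c :: "'a \<Rightarrow> nat"
  assumes "finite F" "peelable V F" "\<And>X. hitting_set V F X \<Longrightarrow> t \<le> sum c X"
  shows "\<exists>y. integral_packing V F c y \<and> (\<Sum>e\<in>F. y e) = t"
  using assms(3)
proof (induction t arbitrary: c)
  case 0
  show ?case by (intro exI[of _ "\<lambda>_. 0"]) (simp add: integral_packing_def)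
next
  case (Suc t)
  have "\<forall>X. hitting_set V F X \<longrightarrow> t < sum c X" using Suc.prems by (simp add: Suc_le_eq)
  then have "\<exists>e\<in>F. (\<forall>v\<in>e. 0 < c v) \<and>
      (\<forall>X. hitting_set V F X \<longrightarrow> t \<le> (\<Sum>v\<in>X. c v - incidence e v))"
    using assms(2) by (simp add: peelable_def)
  then obtain e where e: "e \<in> F" "\<And>v. v \<in> e \<Longrightarrow> 0 < c v"
    "\<And>X. hitting_set V F X \<Longrightarrow> t \<le> (\<Sum>v\<in>X. c v - incidence e v)"
    by blast
  then obtain y where y: "integral_packing V F (\<lambda>v. c v - incidence e v) y" "(\<Sum>e\<in>F. y e) = t"
    using Suc.IH by blast
  have "(\<Sum>f\<in>F. (y(e := Suc (y e))) f) = Suc t"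
    using y(2) assms(1) e(1) by (simp add: sum.remove[of F e])
  then show ?case
    using integral_packing_add_edge[OF assms(1) e(1,2) y(1)] by blast
qed

lemma mengerian_if_peelable:
  assumes V: "finite V" and F: "F \<subseteq> Pow V" "{} \<notin> F" and "peelable V F"
  shows "mengerian V F"
proof (rule mengerianI)
  fix c :: "'a \<Rightarrow> nat"
  have "finite F" using V F(1) by (metis finite_Pow_iff finite_subset)
  have "hitting_set V F V"
    using F by (auto simp: hitting_set_def) (metis Int_absorb2 PowD subsetD)
  then obtain X where X: "hitting_set V F X"
    and min: "\<And>X'. hitting_set V F X' \<Longrightarrow> sum c X \<le> sum c X'"
    using ex_has_least_nat[of "hitting_set V F" V "sum c"] by blast
  obtain y where "integral_packing V F c y" "(\<Sum>e\<in>F. y e) = sum c X"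
    using peelable_packing[OF \<open>finite F\<close> assms(4) min] by blast
  then show "\<exists>x y. integral_cover V F x \<and> integral_packing V F c y \<and>
      (\<Sum>v\<in>V. c v * x v) \<le> (\<Sum>e\<in>F. y e)"
    using integral_cover_hitting_set[OF V X] sum_mult_hitting_set[OF V X] by (metis order_refl)
qed

subsection \<open>Transversals of consecutive layers\<close>

definition layer_transversals :: "nat \<Rightarrow> 'a set \<Rightarrow> ('a \<Rightarrow> nat) \<Rightarrow> 'a set set" where
  "layer_transversals k V pos = {e. e \<subseteq> V \<and> (\<exists>i. bij_betw pos e {i..<i + k})}"

lemma transversal_of_window:
  assumes "\<And>j. j \<in> {i..<i + k} \<Longrightarrow> \<exists>v\<in>V. pos v = j \<and> P v"
  obtains e where "e \<subseteq> V" "bij_betw pos e {i..<i + k}" "\<forall>v\<in>e. P v"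
proof -
  obtain f where f: "\<And>j. j \<in> {i..<i + k} \<Longrightarrow> f j \<in> V \<and> pos (f j) = j \<and> P (f j)"
    using assms by metis
  show thesis
  proof (rule that[of "f ` {i..<i + k}"])
    show "bij_betw pos (f ` {i..<i + k}) {i..<i + k}"
      by (rule bij_betw_byWitness[where f' = f]) (use f in auto)
  qed (use f in auto)
qed

lemma hitting_set_layers:
  assumes "\<And>i. J \<inter> {i..<i + k} \<noteq> {}"
  shows "hitting_set V (layer_transversals k V pos) {v\<in>V. pos v \<in> J}"
  unfolding hitting_set_def
proof (intro conjI ballI)
  fix e assume "e \<in> layer_transversals k V pos"
  then obtain i where e: "e \<subseteq> V" "pos ` e = {i..<i + k}"
    by (auto simp: layer_transversals_def bij_betw_def)
  obtain j where "j \<in> J" "j \<in> pos ` e" using assms[of i] e(2) by blast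
  then show "e \<inter> {v\<in>V. pos v \<in> J} \<noteq> {}" using e(1) by blast
qed simp

lemma hitting_set_contains_layer:
  assumes "hitting_set V (layer_transversals k V pos) X"
  shows "\<exists>j\<in>{i..<i + k}. {v\<in>V. pos v = j} \<subseteq> X"
proof (rule ccontr)
  assume "\<not> ?thesis"
  then have "\<exists>v\<in>V. pos v = j \<and> v \<notin> X" if "j \<in> {i..<i + k}" for j using that by blast
  then obtain e where "e \<subseteq> V" "bij_betw pos e {i..<i + k}" "\<forall>v\<in>e. v \<notin> X"
    by (rule transversal_of_window)
  then show False
    using assms by (auto simp: hitting_set_def layer_transversals_def)
qed

definition null_layers :: "'a set \<Rightarrow> ('a \<Rightarrow> nat) \<Rightarrow> ('a \<Rightarrow> nat) \<Rightarrow> nat set" where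
  "null_layers V pos c = {j. \<forall>v\<in>V. pos v = j \<longrightarrow> c v = 0}"

lemma hit_windows_thin:
  fixes J Z :: "nat set"
  assumes J: "\<And>s. J \<inter> {s..<s + k} \<noteq> {}" and left: "\<And>s. s < i \<Longrightarrow> Z \<inter> {s..<s + k} \<noteq> {}"
    and m: "m = Max (J \<inter> {i..<i + k})"
  shows "(Z \<union> insert m {j\<in>J. i + k \<le> j}) \<inter> {s..<s + k} \<noteq> {}"
proof (cases "s < i")
  case False
  obtain j where j: "j \<in> J" "s \<le> j" "j < s + k" using J[of s] by auto
  have "m < i + k" using Max_in[of "J \<inter> {i..<i + k}"] J by (auto simp: m)
  moreover have "j \<le> m" if "j < i + k"
    using that j \<open>\<not> s < i\<close> by (auto simp: m intro: Max_ge)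
  ultimately have "j \<in> {j\<in>J. i + k \<le> j} \<inter> {s..<s + k} \<or> m \<in> {s..<s + k}"
    using j \<open>\<not> s < i\<close> by fastforce
  then show ?thesis by blast
qed (use left in blast)

text \<open>The windows further left are hit by layers of weight zero, so only the last layer of a hitting set
  in the window at \<open>i\<close> is needed.\<close>

lemma leftmost_window_peel:
  fixes c :: "'a \<Rightarrow> nat"
  assumes V: "finite V" and heavy: "\<And>X. hitting_set V (layer_transversals k V pos) X \<Longrightarrow> t < sum c X"
    and left: "\<And>s. s < i \<Longrightarrow> null_layers V pos c \<inter> {s..<s + k} \<noteq> {}"
    and e: "bij_betw pos e {i..<i + k}" and pos: "\<And>v. v \<in> e \<Longrightarrow> 0 < c v"
    and X: "hitting_set V (layer_transversals k V pos) X"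
  shows "t \<le> (\<Sum>v\<in>X. c v - incidence e v)"
proof -
  define J where "J = {j. {v\<in>V. pos v = j} \<subseteq> X}"
  have J: "J \<inter> {s..<s + k} \<noteq> {}" for s
    using hitting_set_contains_layer[OF X, of s] by (auto simp: J_def)
  define m where "m = Max (J \<inter> {i..<i + k})"
  define Y where "Y = {v\<in>V. pos v \<in> insert m {j\<in>J. i + k \<le> j}}"
  have "t < sum c {v\<in>V. pos v \<in> null_layers V pos c \<union> insert m {j\<in>J. i + k \<le> j}}"
    by (intro heavy hitting_set_layers hit_windows_thin[OF J left m_def])
  also have "\<dots> = sum c Y"
    using V by (intro sum.mono_neutral_right) (auto simp: null_layers_def Y_def)
  also have "\<dots> = (\<Sum>v\<in>Y. c v - incidence e v) + card (e \<inter> Y)"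
    using V pos by (intro sum_eq_sum_diff_incidence) (auto simp: Y_def)
  also have "\<dots> \<le> (\<Sum>v\<in>X. c v - incidence e v) + 1"
  proof (rule add_mono)
    have "m \<in> J" using Max_in[of "J \<inter> {i..<i + k}"] J by (auto simp: m_def)
    then have "Y \<subseteq> X" by (auto simp: Y_def J_def)
    moreover have "X \<subseteq> V" using X by (simp add: hitting_set_def)
    ultimately show "(\<Sum>v\<in>Y. c v - incidence e v) \<le> (\<Sum>v\<in>X. c v - incidence e v)"
      using V by (intro sum_mono2) (auto intro: finite_subset)
    have "pos v < i + k" if "v \<in> e" for v using bij_betwE[OF e] that by auto
    then have "pos ` (e \<inter> Y) \<subseteq> {m}" by (force simp: Y_def)
    moreover have "inj_on pos (e \<inter> Y)"
      using e by (auto simp: bij_betw_def intro: inj_on_subset)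
    ultimately show "card (e \<inter> Y) \<le> 1"
      using card_inj_on_le[of pos _ "{m}"] by simp
  qed
  finally show ?thesis by simp
qed

lemma peelable_layer_transversals:
  assumes "finite V"
  shows "peelable V (layer_transversals k V pos)"
  unfolding peelable_def
proof (intro allI impI)
  fix c :: "'a \<Rightarrow> nat" and t
  let ?F = "layer_transversals k V pos"
  assume "\<forall>X. hitting_set V ?F X \<longrightarrow> t < sum c X"
  then have heavy: "t < sum c X" if "hitting_set V ?F X" for X using that by blast
  have "\<exists>i. null_layers V pos c \<inter> {i..<i + k} = {}"
  proof (rule ccontr)
    assume "\<nexists>i. null_layers V pos c \<inter> {i..<i + k} = {}"
    then have "t < sum c {v\<in>V. pos v \<in> null_layers V pos c}" by (intro heavy hitting_set_layers) blast
    then show False by (simp add: null_layers_def)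
  qed
  then obtain i where i: "null_layers V pos c \<inter> {i..<i + k} = {}"
    and left: "\<And>s. s < i \<Longrightarrow> null_layers V pos c \<inter> {s..<s + k} \<noteq> {}"
    using exists_least_iff[of "\<lambda>i. null_layers V pos c \<inter> {i..<i + k} = {}"] by auto
  have "\<exists>v\<in>V. pos v = j \<and> 0 < c v" if "j \<in> {i..<i + k}" for j
    using that i by (auto simp: null_layers_def)
  then obtain e where e: "e \<subseteq> V" "bij_betw pos e {i..<i + k}" and pos: "\<forall>v\<in>e. 0 < c v"
    by (rule transversal_of_window)
  have "t \<le> (\<Sum>v\<in>X. c v - incidence e v)" if "hitting_set V ?F X" for X
    using leftmost_window_peel[OF assms heavy left e(2) _ that] pos by blast
  then show "\<exists>e\<in>?F. (\<forall>v\<in>e. 0 < c v) \<and>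
      (\<forall>X. hitting_set V ?F X \<longrightarrow> t \<le> (\<Sum>v\<in>X. c v - incidence e v))"
    using e pos by (auto simp: layer_transversals_def)
qed

theorem mengerian_layer_transversals:
  assumes "finite V" "0 < k"
  shows "mengerian V (layer_transversals k V pos)"
proof (rule mengerian_if_peelable[OF assms(1) _ _ peelable_layer_transversals[OF assms(1)]])
  show "{} \<notin> layer_transversals k V pos"
    using assms(2) by (auto simp: layer_transversals_def bij_betw_def)
qed (auto simp: layer_transversals_def)

lemma layer_transversals_4_iff:
  "e \<in> layer_transversals 4 V pos \<longleftrightarrow> e \<subseteq> V \<and>
    (\<exists>a b c d. e = {a, b, c, d} \<and> pos b = pos a + 1 \<and> pos c = pos a + 2 \<and> pos d = pos a + 3)"
proof -
  have window: "{i..<i + 4} = {i, i + 1, i + 2, i + 3}" for i :: nat by auto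
  have "(\<exists>i. bij_betw pos e {i..<i + 4}) \<longleftrightarrow>
    (\<exists>a b c d. e = {a, b, c, d} \<and> pos b = pos a + 1 \<and> pos c = pos a + 2 \<and> pos d = pos a + 3)"
  proof
    assume "\<exists>i. bij_betw pos e {i..<i + 4}"
    then obtain i where bij: "bij_betw pos e {i..<i + 4}" by blast
    define g where "g = the_inv_into e pos"
    have g: "bij_betw g {i..<i + 4} e" "\<And>j. j \<in> {i..<i + 4} \<Longrightarrow> pos (g j) = j"
      using bij by (auto simp: g_def bij_betw_the_inv_into f_the_inv_into_f_bij_betw)
    have "e = {g i, g (i + 1), g (i + 2), g (i + 3)}"
      using bij_betw_imp_surj_on[OF g(1)] by (simp add: window)
    then show "\<exists>a b c d. e = {a, b, c, d} \<and> pos b = pos a + 1 \<and> pos c = pos a + 2 \<and> pos d = pos a + 3"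
      using g(2)
      by (intro exI[of _ "g i"] exI[of _ "g (i + 1)"] exI[of _ "g (i + 2)"] exI[of _ "g (i + 3)"]) simp
  next
    assume "\<exists>a b c d. e = {a, b, c, d} \<and> pos b = pos a + 1 \<and> pos c = pos a + 2 \<and> pos d = pos a + 3"
    then obtain a b c d
      where "e = {a, b, c, d}" "pos b = pos a + 1" "pos c = pos a + 2" "pos d = pos a + 3"
      by blast
    then have "bij_betw pos e {pos a..<pos a + 4}" by (auto simp: bij_betw_def inj_on_def window)
    then show "\<exists>i. bij_betw pos e {i..<i + 4}" by blast
  qed
  then show ?thesis by (simp add: layer_transversals_def)
qed

subsection \<open>The windows of the eight-cycle\<close>

text \<open>The minimal hitting sets of the eight windows of length 4 are the pairs \<open>{i, i + 4}\<close> and the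
  triples \<open>{i, i + 3, i + 6}\<close>. A window meets every pair once, and the window at \<open>s\<close> meets exactly the
  triples with \<open>i - s \<in> {0, 2, 3, 5}\<close> twice; so it can be removed if these triples are not tight.\<close>

definition heavy_octagon :: "nat \<Rightarrow> (int \<Rightarrow> nat) \<Rightarrow> bool" where
  "heavy_octagon t c \<longleftrightarrow>
    (\<forall>i. c (i + 8) = c i \<and> t \<le> c i + c (i + 4) \<and> t \<le> c i + c (i + 3) + c (i + 6))"

definition removable_window :: "nat \<Rightarrow> (int \<Rightarrow> nat) \<Rightarrow> int \<Rightarrow> bool" where
  "removable_window t c s \<longleftrightarrow> (\<forall>i\<in>{0, 1, 2, 3}. 0 < c (s + i)) \<and>
    (\<forall>i\<in>{0, 2, 3, 5}. t < c (s + i) + c (s + (i + 3)) + c (s + (i + 6)))"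

lemma heavy_octagon_shift: "heavy_octagon t c \<Longrightarrow> heavy_octagon t (\<lambda>i. c (a + i))"
  unfolding heavy_octagon_def by (metis add.assoc)

lemma removable_window_shift:
  "removable_window t (\<lambda>i. c (a + i)) s \<longleftrightarrow> removable_window t c (a + s)"
  by (simp add: removable_window_def add.assoc)

lemma heavy_octagon_unroll:
  assumes "heavy_octagon t c"
  shows "c 8 = c 0" "c 9 = c 1" "c 10 = c 2" "c 11 = c 3" "c 12 = c 4" "c 13 = c 5"
      "c 14 = c 6" "c 15 = c 7"
    and "t \<le> c 0 + c 4" "t \<le> c 1 + c 5" "t \<le> c 2 + c 6" "t \<le> c 3 + c 7"
    and "t \<le> c 0 + c 3 + c 6" "t \<le> c 1 + c 4 + c 7" "t \<le> c 2 + c 5 + c 0" "t \<le> c 3 + c 6 + c 1"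
      "t \<le> c 4 + c 7 + c 2" "t \<le> c 5 + c 0 + c 3" "t \<le> c 6 + c 1 + c 4" "t \<le> c 7 + c 2 + c 5"
proof -
  have per: "c (i + 8) = c i" and pair: "t \<le> c i + c (i + 4)"
    and triple: "t \<le> c i + c (i + 3) + c (i + 6)" for i
    using assms by (auto simp: heavy_octagon_def)
  show per8: "c 8 = c 0" "c 9 = c 1" "c 10 = c 2" "c 11 = c 3" "c 12 = c 4" "c 13 = c 5"
      "c 14 = c 6" "c 15 = c 7"
    using per[of 0] per[of 1] per[of 2] per[of 3] per[of 4] per[of 5] per[of 6] per[of 7] by simp_all
  show "t \<le> c 0 + c 4" "t \<le> c 1 + c 5" "t \<le> c 2 + c 6" "t \<le> c 3 + c 7"
    using pair[of 0] pair[of 1] pair[of 2] pair[of 3] by simp_all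
  show "t \<le> c 0 + c 3 + c 6" "t \<le> c 1 + c 4 + c 7" "t \<le> c 2 + c 5 + c 0" "t \<le> c 3 + c 6 + c 1"
      "t \<le> c 4 + c 7 + c 2" "t \<le> c 5 + c 0 + c 3" "t \<le> c 6 + c 1 + c 4" "t \<le> c 7 + c 2 + c 5"
    using triple[of 0] triple[of 1] triple[of 2] triple[of 3] triple[of 4] triple[of 5]
      triple[of 6] triple[of 7] by (simp_all add: per8)
qed

lemma removable_window_near_zero:
  assumes heavy: "heavy_octagon t c" and "0 < t" "c 0 = 0"
  shows "\<exists>s\<in>{1, 2, 3, 4}. removable_window t c s"
proof (rule ccontr)
  note unroll = heavy_octagon_unroll[OF heavy]
  assume "\<not> ?thesis"
  then have none: "\<not> removable_window t c 1" "\<not> removable_window t c 2"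
      "\<not> removable_window t c 3" "\<not> removable_window t c 4" by simp_all
  have c4: "t \<le> c 4" using unroll(9) assms(3) by simp
  have "c 1 = 0 \<or> c 2 = 0 \<or> c 3 = 0"
    using none(1) c4 unroll assms(2,3) by (auto simp: removable_window_def)
  then have c5: "t \<le> c 5" using unroll assms(3) by auto
  have "c 5 = 0 \<or> c 6 = 0 \<or> c 7 = 0"
    using none(4) c4 unroll assms(2,3) by (auto simp: removable_window_def)
  then have c3: "t \<le> c 3" using unroll assms(3) by auto
  have "c 2 = 0" using none(2) c3 c4 c5 unroll assms(2,3) by (auto simp: removable_window_def)
  moreover have "c 6 = 0" using none(3) c3 c4 c5 unroll assms(2,3) by (auto simp: removable_window_def)
  ultimately show False using unroll(11) assms(2) by simp
qed

lemma removable_window_opposite_tight: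
  assumes heavy: "heavy_octagon t c" and pos: "\<And>i. 0 < c i" and tight: "c 0 + c 3 + c 6 = t"
  shows "removable_window t c 4"
  using heavy_octagon_unroll[OF heavy] pos[of 0] pos[of 1] pos[of 2] pos[of 3] pos[of 4] pos[of 5]
    pos[of 6] pos[of 7] tight
  by (simp add: removable_window_def)

lemma removable_window_exists:
  assumes heavy: "heavy_octagon t c" and "0 < t"
  shows "\<exists>s. removable_window t c s"
proof -
  consider (zero) a where "c a = 0"
    | (tight) a where "\<And>i. 0 < c i" "c a + c (a + 3) + c (a + 6) = t"
    | (slack) "\<And>i. 0 < c i" "\<And>a. t < c a + c (a + 3) + c (a + 6)"
    using heavy unfolding heavy_octagon_def by (metis gr0I le_neq_implies_less)
  then show ?thesis
  proof cases
    case (zero a)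
    then show ?thesis
      using removable_window_near_zero[OF heavy_octagon_shift[OF heavy] assms(2), of a]
      by (auto simp: removable_window_shift)
  next
    case (tight a)
    then have "removable_window t (\<lambda>i. c (a + i)) 4"
      by (intro removable_window_opposite_tight heavy_octagon_shift[OF heavy]) simp_all
    then show ?thesis by (auto simp: removable_window_shift)
  next
    case slack
    then have "removable_window t c 0"
      using slack(2)[of 0] slack(2)[of 2] slack(2)[of 3] slack(2)[of 5]
      by (simp add: removable_window_def)
    then show ?thesis by blast
  qed
qed

lemma image_int_window: "f ` {s..s + 3 :: int} = {f s, f (s + 1), f (s + 2), f (s + 3)}"
proof -
  have "{s..s + 3} = {s, s + 1, s + 2, s + 3}" by auto
  then show ?thesis by simp
qed

locale octagon =
  fixes v :: "int \<Rightarrow> 'a"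
  assumes eq_iff: "v i = v j \<longleftrightarrow> i mod 8 = j mod 8"
begin

abbreviation windows :: "'a set set" where
  "windows \<equiv> range (\<lambda>s. v ` {s..s + 3})"

lemma in_window_iff: "v (s + k) \<in> v ` {s..s + 3} \<longleftrightarrow> k mod 8 < 4"
proof
  assume "v (s + k) \<in> v ` {s..s + 3}"
  then obtain i where i: "i \<in> {s..s + 3}" "(s + k) mod 8 = i mod 8" by (auto simp: eq_iff)
  have "k mod 8 = (i - s) mod 8"
    using i(2) mod_diff_cong[of "s + k" 8 i s s] by simp
  also have "\<dots> = i - s" using i(1) by simp
  finally show "k mod 8 < 4" using i(1) by simp
next
  assume "k mod 8 < 4"
  then have "s + k mod 8 \<in> {s..s + 3}" by simp
  moreover have "v (s + k) = v (s + k mod 8)" by (simp add: eq_iff mod_simps)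
  ultimately show "v (s + k) \<in> v ` {s..s + 3}" by blast
qed

lemma vertex_at_offset:
  obtains k where "k \<in> {0, 1, 2, 3, 4, 5, 6, 7}" "\<And>d. v (i + d) = v (s + (k + d))"
proof
  show "v (i + d) = v (s + ((i - s) mod 8 + d))" for d
    using mod_add_left_eq[of "i - s" 8 "s + d"] by (simp add: eq_iff algebra_simps)
  show "(i - s) mod 8 \<in> {0, 1, 2, 3, 4, 5, 6, 7}"
    using pos_mod_bound[of 8 "i - s"] pos_mod_sign[of 8 "i - s"] by auto
qed

lemma finite_range: "finite (range v)"
proof (rule finite_subset)
  show "range v \<subseteq> v ` {0..<8}"
  proof clarify
    fix i
    have "v i = v (i mod 8)" by (simp add: eq_iff)
    then show "v i \<in> v ` {0..<8}" by simp
  qed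
qed simp

lemma hitting_set_pair: "hitting_set (range v) windows {v i, v (i + 4)}"
proof -
  have "v ` {s..s + 3} \<inter> {v i, v (i + 4)} \<noteq> {}" for s
  proof -
    obtain k where "k \<in> {0, 1, 2, 3, 4, 5, 6, 7}" and v: "\<And>d. v (i + d) = v (s + (k + d))"
      using vertex_at_offset[of i s] by blast
    then have "v (s + k) \<in> v ` {s..s + 3} \<or> v (s + (k + 4)) \<in> v ` {s..s + 3}"
      unfolding in_window_iff by auto
    then show ?thesis using v[of 0] v[of 4] by auto
  qed
  then show ?thesis by (auto simp: hitting_set_def)
qed

lemma hitting_set_triple: "hitting_set (range v) windows {v i, v (i + 3), v (i + 6)}"
proof -
  have "v ` {s..s + 3} \<inter> {v i, v (i + 3), v (i + 6)} \<noteq> {}" for s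
  proof -
    obtain k where "k \<in> {0, 1, 2, 3, 4, 5, 6, 7}" and v: "\<And>d. v (i + d) = v (s + (k + d))"
      using vertex_at_offset[of i s] by blast
    then have "v (s + k) \<in> v ` {s..s + 3} \<or> v (s + (k + 3)) \<in> v ` {s..s + 3} \<or>
        v (s + (k + 6)) \<in> v ` {s..s + 3}"
      unfolding in_window_iff by auto
    then show ?thesis using v[of 0] v[of 3] v[of 6] by auto
  qed
  then show ?thesis by (auto simp: hitting_set_def)
qed

lemma hitting_set_contains_pair_or_triple:
  assumes "hitting_set (range v) windows X"
  shows "(\<exists>k\<in>{0, 1, 2, 3}. {v (s + k), v (s + (k + 4))} \<subseteq> X) \<or>
    (\<exists>k\<in>{0, 1, 2, 3, 4, 5, 6, 7}. {v (s + k), v (s + (k + 3)), v (s + (k + 6))} \<subseteq> X)"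
proof -
  define P where "P k \<longleftrightarrow> v (s + k) \<in> X" for k
  have per: "P (k + 8) \<longleftrightarrow> P k" for k
    using eq_iff[of "s + (k + 8)" "s + k"] by (simp add: P_def add.assoc[symmetric])
  have per8: "P 8 \<longleftrightarrow> P 0" "P 9 \<longleftrightarrow> P 1" "P 10 \<longleftrightarrow> P 2" "P 11 \<longleftrightarrow> P 3" "P 12 \<longleftrightarrow> P 4" "P 13 \<longleftrightarrow> P 5"
    using per[of 0] per[of 1] per[of 2] per[of 3] per[of 4] per[of 5] by simp_all
  have hit: "P k \<or> P (k + 1) \<or> P (k + 2) \<or> P (k + 3)" for k
  proof -
    have "v ` {s + k..s + k + 3} \<inter> X \<noteq> {}" using assms by (auto simp: hitting_set_def)
    then show ?thesis unfolding image_int_window by (auto simp: P_def add.assoc)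
  qed
  have "(P 0 \<and> P 4) \<or> (P 1 \<and> P 5) \<or> (P 2 \<and> P 6) \<or> (P 3 \<and> P 7) \<or>
      (P 0 \<and> P 3 \<and> P 6) \<or> (P 1 \<and> P 4 \<and> P 7) \<or> (P 2 \<and> P 5 \<and> P 0) \<or> (P 3 \<and> P 6 \<and> P 1) \<or>
      (P 4 \<and> P 7 \<and> P 2) \<or> (P 5 \<and> P 0 \<and> P 3) \<or> (P 6 \<and> P 1 \<and> P 4) \<or> (P 7 \<and> P 2 \<and> P 5)"
    using hit[of 0] hit[of 1] hit[of 2] hit[of 3] hit[of 4] hit[of 5] hit[of 6] hit[of 7]
    by (simp add: per8) argo
  then show ?thesis
    by (simp add: per8 flip: P_def)
qed

lemma removable_window_peel:
  assumes heavy: "heavy_octagon (Suc t) (\<lambda>i. c (v i))"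
    and removable: "removable_window (Suc t) (\<lambda>i. c (v i)) s"
    and X: "hitting_set (range v) windows X"
  shows "t \<le> (\<Sum>u\<in>X. c u - incidence (v ` {s..s + 3}) u)" (is "_ \<le> sum ?c' X")
proof -
  have "finite X" using X finite_range by (auto simp: hitting_set_def intro: finite_subset)
  have c': "?c' (v (s + k)) = c (v (s + k)) - of_bool (k mod 8 < 4)" for k
    by (simp add: incidence_def in_window_iff)
  have bound: "t \<le> sum ?c' X" if "Y \<subseteq> X" "t \<le> sum ?c' Y" for Y
    using that \<open>finite X\<close> sum_mono2[of X Y ?c'] by force
  have pair: "Suc t \<le> c (v (s + k)) + c (v (s + (k + 4)))"
    and triple: "Suc t \<le> c (v (s + k)) + c (v (s + (k + 3))) + c (v (s + (k + 6)))" for k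
    using heavy unfolding heavy_octagon_def by (metis add.assoc)+
  have per: "v (s + 8) = v s" "v (s + 9) = v (s + 1)" "v (s + 11) = v (s + 3)"
    by (simp_all add: eq_iff mod_eq_dvd_iff)
  have eq: "v (s + i) = v (s + j) \<longleftrightarrow> 8 dvd i - j" for i j
    by (simp add: eq_iff mod_eq_dvd_iff)
  from hitting_set_contains_pair_or_triple[OF X, of s] show ?thesis
  proof (elim disjE bexE)
    fix k :: int assume k: "k \<in> {0, 1, 2, 3}" and Y: "{v (s + k), v (s + (k + 4))} \<subseteq> X"
    show ?thesis
      by (rule bound[OF Y])
        (use k pair[of k] removable in \<open>auto simp: c' eq per removable_window_def\<close>)
  next
    fix k :: int assume k: "k \<in> {0, 1, 2, 3, 4, 5, 6, 7}"
      and Y: "{v (s + k), v (s + (k + 3)), v (s + (k + 6))} \<subseteq> X"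
    show ?thesis
      by (rule bound[OF Y])
        (use k triple[of k] removable in \<open>auto simp: c' eq per removable_window_def\<close>)
  qed
qed

lemma peelable_windows: "peelable (range v) windows"
  unfolding peelable_def
proof (intro allI impI)
  fix c :: "'a \<Rightarrow> nat" and t
  assume weight: "\<forall>X. hitting_set (range v) windows X \<longrightarrow> t < sum c X"
  have heavy: "heavy_octagon (Suc t) (\<lambda>i. c (v i))"
    unfolding heavy_octagon_def
  proof (intro allI conjI)
    fix i
    show "c (v (i + 8)) = c (v i)" using eq_iff[of "i + 8" i] by simp
    show "Suc t \<le> c (v i) + c (v (i + 4))"
      using weight[rule_format, OF hitting_set_pair, of i] by (simp add: eq_iff mod_eq_dvd_iff)
    show "Suc t \<le> c (v i) + c (v (i + 3)) + c (v (i + 6))"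
      using weight[rule_format, OF hitting_set_triple, of i] by (simp add: eq_iff mod_eq_dvd_iff)
  qed
  then obtain s where s: "removable_window (Suc t) (\<lambda>i. c (v i)) s"
    using removable_window_exists by blast
  then have "\<forall>u\<in>v ` {s..s + 3}. 0 < c u" by (simp add: removable_window_def image_int_window)
  then show "\<exists>e\<in>windows. (\<forall>u\<in>e. 0 < c u) \<and>
      (\<forall>X. hitting_set (range v) windows X \<longrightarrow> t \<le> (\<Sum>u\<in>X. c u - incidence e u))"
    using removable_window_peel[OF heavy s] by blast
qed

theorem mengerian_windows: "mengerian (range v) windows"
  using finite_range peelable_windows by (intro mengerian_if_peelable) auto

end

subsection \<open>Minors and a divisibility obstruction\<close>

definition minor :: "'a set set \<Rightarrow> 'a set \<Rightarrow> 'a set \<Rightarrow> 'a set set" where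
  "minor F U D = (\<lambda>e. e \<inter> U) ` {e\<in>F. e \<subseteq> U \<union> D}"

lemma integral_packing_eq_0:
  assumes "finite F" "integral_packing V F c y" "e \<in> F" "w \<in> e" "w \<in> V" "c w = 0"
  shows "y e = 0"
proof -
  have "y e * incidence e w \<le> (\<Sum>e\<in>F. y e * incidence e w)"
    using assms(1,3) by (intro member_le_sum) auto
  also have "\<dots> \<le> 0"
    using assms(2,5,6) by (metis integral_packing_def)
  finally show ?thesis using assms(4) by (simp add: incidence_def)
qed

lemma integral_cover_minor:
  assumes "finite V" "integral_cover V F x" "U \<subseteq> V" "\<And>w. w \<in> D \<Longrightarrow> x w = 0"
  shows "integral_cover U (minor F U D) x"
  unfolding integral_cover_def
proof
  fix f assume "f \<in> minor F U D"
  then obtain e where e: "e \<in> F" "e \<subseteq> U \<union> D" "f = e \<inter> U" by (auto simp: minor_def)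
  have "1 \<le> (\<Sum>v\<in>V. incidence e v * x v)" using assms(2) e(1) by (simp add: integral_cover_def)
  also have "\<dots> = (\<Sum>v\<in>U. incidence f v * x v)"
    using assms(1,3,4) e by (intro sum.mono_neutral_cong_right) (auto simp: incidence_def)
  finally show "1 \<le> (\<Sum>v\<in>U. incidence f v * x v)" .
qed

lemma integral_packing_minor:
  assumes "finite F" "F \<subseteq> Pow V" "U \<subseteq> V" and packing: "integral_packing V F c y"
    and c: "\<And>v. v \<in> V \<Longrightarrow> v \<notin> U \<Longrightarrow> v \<notin> D \<Longrightarrow> c v = 0"
  obtains y' where "integral_packing U (minor F U D) c y'" "(\<Sum>f\<in>minor F U D. y' f) = (\<Sum>e\<in>F. y e)"
proof
  let ?F = "{e\<in>F. e \<subseteq> U \<union> D}"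
  define y' where "y' f = (\<Sum>e\<in>{e\<in>?F. e \<inter> U = f}. y e)" for f
  have supp: "(\<Sum>e\<in>?F. y e * g e) = (\<Sum>e\<in>F. y e * g e)" for g
  proof (intro sum.mono_neutral_left ballI)
    fix e assume e: "e \<in> F - ?F"
    then obtain w where w: "w \<in> e" "w \<notin> U" "w \<notin> D" by blast
    then have "w \<in> V" using e assms(2) by blast
    then have "y e = 0"
      using integral_packing_eq_0[OF assms(1) packing _ w(1)] c[OF _ w(2,3)] e by auto
    then show "y e * g e = 0" by simp
  qed (use assms(1) in auto)
  have fibres: "(\<Sum>f\<in>minor F U D. \<Sum>e\<in>{e\<in>?F. e \<inter> U = f}. g e) = sum g ?F" for g :: "'a set \<Rightarrow> nat"
    unfolding minor_def using assms(1) by (intro sum.image_gen[symmetric]) auto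
  show "(\<Sum>f\<in>minor F U D. y' f) = (\<Sum>e\<in>F. y e)"
    using fibres[of y] supp[of "\<lambda>_. 1"] by (simp add: y'_def)
  show "integral_packing U (minor F U D) c y'"
    unfolding integral_packing_def
  proof
    fix v assume v: "v \<in> U"
    have "(\<Sum>f\<in>minor F U D. y' f * incidence f v)
        = (\<Sum>f\<in>minor F U D. \<Sum>e\<in>{e\<in>?F. e \<inter> U = f}. y e * incidence e v)"
      using v by (auto simp: y'_def sum_distrib_right incidence_def intro!: sum.cong)
    also have "\<dots> = (\<Sum>e\<in>F. y e * incidence e v)" using fibres supp by simp
    also have "\<dots> \<le> c v" using packing v assms(3) by (auto simp: integral_packing_def)
    finally show "(\<Sum>f\<in>minor F U D. y' f * incidence f v) \<le> c v" .
  qed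
qed

lemma hitting_set_minor:
  assumes "F \<subseteq> Pow V" "U \<inter> D = {}" "{} \<notin> minor F U D"
  shows "hitting_set V F (V - D)"
  unfolding hitting_set_def
proof (intro conjI ballI notI)
  fix e assume e: "e \<in> F" "e \<inter> (V - D) = {}"
  then have "e \<subseteq> D" "e \<inter> U \<subseteq> {}" using assms(1,2) by blast+
  then have "{} \<in> minor F U D"
    unfolding minor_def using e(1) by (intro image_eqI[of _ _ e]) auto
  then show False using assms(3) by contradiction
qed auto

text \<open>Deleted vertices get weight zero and contracted ones a weight exceeding that of the hitting set
  formed by all other vertices.\<close>

lemma mengerian_minor:
  fixes V :: "'a set"
  assumes "mengerian V F" and V: "finite V" and F: "F \<subseteq> Pow V"
    and UD: "U \<union> D \<subseteq> V" "U \<inter> D = {}" and nonempty: "{} \<notin> minor F U D"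
  shows "mengerian U (minor F U D)"
proof (rule mengerianI)
  fix c :: "'a \<Rightarrow> nat"
  define c' where "c' v = (if v \<in> U then c v else if v \<in> D then Suc (sum c U) else 0)" for v
  obtain x y where cover: "integral_cover V F x" and packing: "integral_packing V F c' y"
    and eq: "(\<Sum>v\<in>V. c' v * x v) = (\<Sum>e\<in>F. y e)"
    using mengerianE[OF assms(1)] .
  have "finite F" using V F by (metis finite_Pow_iff finite_subset)
  then obtain y' where "integral_packing U (minor F U D) c' y'"
    and total: "(\<Sum>f\<in>minor F U D. y' f) = (\<Sum>e\<in>F. y e)"
    using integral_packing_minor[OF _ F _ packing, of U D] UD(1) by (auto simp: c'_def)
  then have packing': "integral_packing U (minor F U D) c y'"
    by (simp add: integral_packing_def c'_def)
  note hitting = hitting_set_minor[OF F UD(2) nonempty]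
  have "(\<Sum>e\<in>F. y e) \<le> sum c' (V - D)"
    using weak_duality[OF integral_cover_hitting_set[OF V hitting] packing]
    unfolding sum_mult_hitting_set[OF V hitting] .
  also have "\<dots> = sum c U"
    using V UD by (intro sum.mono_neutral_cong_right) (auto simp: c'_def)
  finally have le: "(\<Sum>v\<in>V. c' v * x v) \<le> sum c U" using eq by simp
  have "x w = 0" if "w \<in> D" for w
  proof -
    have "c' w * x w \<le> (\<Sum>v\<in>V. c' v * x v)"
      using that V UD(1) by (intro member_le_sum) auto
    moreover have "c' w = Suc (sum c U)" using that UD(2) by (auto simp: c'_def)
    ultimately have "Suc (sum c U) * x w \<le> sum c U" using le by simp
    then show ?thesis by (cases "x w") auto
  qed
  then have cover': "integral_cover U (minor F U D) x"
    using UD(1) by (intro integral_cover_minor[OF V cover]) auto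
  have "(\<Sum>v\<in>U. c v * x v) = (\<Sum>v\<in>U. c' v * x v)" by (simp add: c'_def)
  also have "\<dots> \<le> (\<Sum>v\<in>V. c' v * x v)" using V UD(1) by (intro sum_mono2) auto
  finally show "\<exists>x y. integral_cover U (minor F U D) x \<and> integral_packing U (minor F U D) c y \<and>
      (\<Sum>v\<in>U. c v * x v) \<le> (\<Sum>f\<in>minor F U D. y f)"
    using cover' packing' eq total by metis
qed

lemma sum_list_rotate: "sum_list (rotate t xs) = sum_list xs"
  for xs :: "'b::comm_monoid_add list"
proof -
  let ?m = "t mod length xs"
  have "sum_list (rotate t xs) = sum_list (take ?m xs) + sum_list (drop ?m xs)"
    by (simp add: rotate_drop_take add.commute)
  also have "\<dots> = sum_list xs" by (metis append_take_drop_id sum_list_append)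
  finally show ?thesis .
qed

lemma sum_add_mod: "(\<Sum>i<n. f ((i + t) mod n)) = (\<Sum>i<n. f i)"
  for f :: "nat \<Rightarrow> 'b::comm_monoid_add"
  using sum_list_rotate[of t "map f [0..<n]"]
  by (simp add: sum_list_sum_nth nth_rotate atLeast0LessThan add.commute)

lemma integral_packing_large_edges:
  assumes "finite U" and packing: "integral_packing U F (\<lambda>_. 1) y"
    and F: "\<And>e. e \<in> F \<Longrightarrow> e \<subseteq> U \<and> k \<le> card e"
  shows "k * (\<Sum>e\<in>F. y e) \<le> card U"
proof -
  have "k * (\<Sum>e\<in>F. y e) \<le> (\<Sum>e\<in>F. y e * card e)"
    using F by (simp add: sum_distrib_left mult.commute sum_mono)
  also have "\<dots> = (\<Sum>e\<in>F. \<Sum>v\<in>U. y e * incidence e v)"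
    using F assms(1)
    by (intro sum.cong)
      (simp_all add: incidence_def Int_absorb1 flip: sum_distrib_left sum.inter_restrict)
  also have "\<dots> = (\<Sum>v\<in>U. \<Sum>e\<in>F. y e * incidence e v)" by (rule sum.swap)
  also have "\<dots> \<le> (\<Sum>v\<in>U. 1)"
    using packing by (intro sum_mono) (auto simp: integral_packing_def)
  finally show ?thesis by simp
qed

text \<open>For constant weight 1, averaging over the cyclic order shows that covers have weight at least
  \<open>n / k\<close>, whereas packings have at most \<open>n / k\<close> edges.\<close>

lemma not_mengerian_cyclic:
  fixes u :: "nat \<Rightarrow> 'a"
  assumes F: "\<And>e. e \<in> F \<Longrightarrow> e \<subseteq> u ` {..<n} \<and> k \<le> card e"
    and inj: "inj_on u {..<n}" and not_dvd: "\<not> k dvd n"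
    and cyclic: "\<And>i. i < n \<Longrightarrow> \<exists>e\<in>F. e \<subseteq> (\<lambda>t. u ((i + t) mod n)) ` {..<k}"
  shows "\<not> mengerian (u ` {..<n}) F"
proof
  let ?U = "u ` {..<n}"
  assume "mengerian ?U F"
  then obtain x y where cover: "integral_cover ?U F x" and packing: "integral_packing ?U F (\<lambda>_. 1) y"
    and eq: "(\<Sum>v\<in>?U. 1 * x v) = (\<Sum>e\<in>F. y e)"
    by (rule mengerianE)
  have upper: "k * (\<Sum>e\<in>F. y e) \<le> n"
    using integral_packing_large_edges[OF _ packing F] inj by (simp add: card_image)
  have "1 \<le> (\<Sum>t<k. x (u ((i + t) mod n)))" if i: "i < n" for i
  proof -
    obtain e where e: "e \<in> F" "e \<subseteq> (\<lambda>t. u ((i + t) mod n)) ` {..<k}" using cyclic[OF i] by blast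
    have "1 \<le> (\<Sum>v\<in>?U. incidence e v * x v)" using cover e(1) by (simp add: integral_cover_def)
    also have "\<dots> = (\<Sum>v\<in>e. x v)"
      using F[OF e(1)] by (intro sum.mono_neutral_cong_right) (auto simp: incidence_def)
    also have "\<dots> \<le> (\<Sum>v\<in>(\<lambda>t. u ((i + t) mod n)) ` {..<k}. x v)"
      using e(2) by (intro sum_mono2) auto
    also have "\<dots> \<le> (\<Sum>t<k. x (u ((i + t) mod n)))"
      using sum_image_le[of "{..<k}" x "\<lambda>t. u ((i + t) mod n)"] by (simp add: o_def)
    finally show ?thesis .
  qed
  then have "(\<Sum>i<n. 1) \<le> (\<Sum>i<n. \<Sum>t<k. x (u ((i + t) mod n)))" by (intro sum_mono) auto
  also have "\<dots> = (\<Sum>t<k. \<Sum>i<n. x (u ((i + t) mod n)))" by (rule sum.swap)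
  also have "\<dots> = k * (\<Sum>v\<in>?U. 1 * x v)"
    using sum_add_mod[of "\<lambda>i. x (u i)"] inj by (simp add: sum.reindex)
  finally have "n \<le> k * (\<Sum>e\<in>F. y e)" using eq by simp
  then show False using upper not_dvd by (metis dvd_triv_left le_antisym)
qed

corollary not_mengerian_cyclic_minor:
  fixes u :: "nat \<Rightarrow> 'a"
  assumes "finite V" "F \<subseteq> Pow V" "u ` {..<n} \<union> D \<subseteq> V" "u ` {..<n} \<inter> D = {}"
    and "inj_on u {..<n}" "0 < k" "\<not> k dvd n"
    and large: "\<And>e. e \<in> F \<Longrightarrow> e \<subseteq> u ` {..<n} \<union> D \<Longrightarrow> k \<le> card (e \<inter> u ` {..<n})"
    and cyclic: "\<And>i. i < n \<Longrightarrow>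
      \<exists>e\<in>F. e \<subseteq> u ` {..<n} \<union> D \<and> e \<inter> u ` {..<n} \<subseteq> (\<lambda>t. u ((i + t) mod n)) ` {..<k}"
  shows "\<not> mengerian V F"
proof
  let ?U = "u ` {..<n}"
  assume "mengerian V F"
  moreover have "{} \<notin> minor F ?U D" using large assms(6) by (fastforce simp: minor_def)
  ultimately have "mengerian ?U (minor F ?U D)" using assms(1-4) by (intro mengerian_minor)
  moreover have "\<not> mengerian ?U (minor F ?U D)"
  proof (rule not_mengerian_cyclic[OF _ assms(5,7)])
    show "e \<subseteq> ?U \<and> k \<le> card e" if "e \<in> minor F ?U D" for e
      using that large by (auto simp: minor_def)
    show "\<exists>e\<in>minor F ?U D. e \<subseteq> (\<lambda>t. u ((i + t) mod n)) ` {..<k}" if "i < n" for i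
      using cyclic[OF that] unfolding minor_def by blast
  qed
  ultimately show False by contradiction
qed

subsection \<open>Paths and circuits\<close>

context pair_graph
begin

abbreviation adj :: "'a \<Rightarrow> 'a \<Rightarrow> bool" where
  "adj u v \<equiv> (u, v) \<in> parcs G"

abbreviation is_path :: "'a list \<Rightarrow> bool" where
  "is_path p \<equiv> vpath p (with_proj G)"

lemma adj_commute: "adj u v \<longleftrightarrow> adj v u"
  by (blast intro: arcs_symmetric)

lemma adj_irrefl [simp]: "\<not> adj u u"
  using pair_no_loops[of "(u, u)"] by auto

lemma is_path_iff:
  "is_path p \<longleftrightarrow> p \<noteq> [] \<and> set p \<subseteq> pverts G \<and> successively adj p \<and> distinct p"
proof -
  have "set (vwalk_arcs p) \<subseteq> parcs G \<longleftrightarrow> successively adj p"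
    by (induction p rule: vwalk_arcs.induct) auto
  then show ?thesis by (auto simp: vpath_def vwalk_def)
qed

lemma is_pathI:
  assumes "successively adj p" "distinct p" "2 \<le> length p"
  shows "is_path p"
proof -
  have "set p \<subseteq> pverts G"
    using assms(1,3)
  proof (induction p rule: vwalk_arcs.induct)
    case (3 x y p)
    then show ?case by (cases p) (auto dest: in_arcsD1 in_arcsD2)
  qed simp_all
  then show ?thesis using assms by (auto simp: is_path_iff)
qed

lemma is_path_adj_nth: "is_path p \<Longrightarrow> Suc i < length p \<Longrightarrow> adj (p ! i) (p ! Suc i)"
  by (simp add: is_path_iff successively_conv_nth)

lemma is_path_edge: "is_path [a, b] \<longleftrightarrow> adj a b"
  by (auto simp: is_path_iff dest: in_arcsD1 in_arcsD2)

lemma is_path_Cons: "p \<noteq> [] \<Longrightarrow> is_path (a # p) \<longleftrightarrow> adj a (hd p) \<and> a \<notin> set p \<and> is_path p"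
  by (auto simp: is_path_iff successively_Cons dest: in_arcsD1)

lemma is_path_rev: "is_path (rev p) \<longleftrightarrow> is_path p"
  by (auto simp: is_path_iff successively_rev adj_commute)

lemma is_path_take: "is_path p \<Longrightarrow> 0 < n \<Longrightarrow> is_path (take n p)"
  by (auto simp: is_path_iff successively_conv_nth dest: in_set_takeD)

lemma is_path_drop: "is_path p \<Longrightarrow> n < length p \<Longrightarrow> is_path (drop n p)"
  by (auto simp: is_path_iff successively_conv_nth dest: in_set_dropD)

lemma length_path_le: "is_path p \<Longrightarrow> length p \<le> card (pverts G)"
  by (metis card_mono distinct_card is_path_iff pair_finite_verts)

lemma H3I:
  assumes "adj a b" "adj b c" "adj c d" "distinct [a, b, c, d]"
  shows "{a, b, c, d} \<in> H3 G"
proof -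
  have "is_path [a, b, c, d]"
    using assms by (auto simp: is_path_Cons is_path_edge)
  then show ?thesis
    using assms(4) by (auto simp: H3_def is_path_iff intro!: exI[of _ "[a, b, c, d]"])
qed

lemma H3E:
  assumes "e \<in> H3 G"
  obtains a b c d where "e = {a, b, c, d}" "adj a b" "adj b c" "adj c d" "distinct [a, b, c, d]"
proof -
  obtain p where p: "is_path p" "length p = 4" "set p \<subseteq> e" and e: "card e = 4"
    using assms by (auto simp: H3_def)
  then have "set p = e"
    by (metis card.infinite card_subset_eq distinct_card is_path_iff zero_neq_numeral)
  moreover obtain a b c d where "p = [a, b, c, d]"
    using p(2) by (auto simp: eval_nat_numeral length_Suc_conv)
  ultimately show thesis
    using p(1) that[of a b c d] by (auto simp: is_path_iff)
qed

lemma H3_subset_Pow: "H3 G \<subseteq> Pow (pverts G)"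
  by (auto simp: H3_def)

lemma card_H3: "e \<in> H3 G \<Longrightarrow> card e = 4"
  by (simp add: H3_def)

definition circuit :: "'a list \<Rightarrow> bool" where
  "circuit p \<longleftrightarrow> is_path p \<and> 3 \<le> length p \<and> adj (last p) (hd p)"

lemma awalk_vwalk_arcs:
  assumes "successively adj (a # p)" "a \<in> pverts G"
  shows "awalk a (vwalk_arcs (a # p)) (last (a # p)) \<and> pawalk_verts a (vwalk_arcs (a # p)) = a # p"
  using assms
proof (induction p arbitrary: a)
  case (Cons b p)
  then show ?case using Cons.IH[of b] in_arcsD2[of a b] by (auto simp: awalk_def)
qed (simp add: awalk_def)

lemma successively_pawalk_verts:
  assumes "awalk u q w"
  shows "successively adj (pawalk_verts u q)"
    and "hd (pawalk_verts u q) = u" and "last (pawalk_verts u q) = w"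
proof -
  have "successively adj (pawalk_verts u q) \<and> hd (pawalk_verts u q) = u \<and> last (pawalk_verts u q) = w"
    using assms
  proof (induction q arbitrary: u)
    case (Cons e q)
    have "adj (fst e) (snd e)" "fst e = u" "awalk (snd e) q w"
      using Cons.prems by (auto simp: awalk_def dest: in_arcsD2)
    then show ?case using Cons.IH[of "snd e"]
      by (auto simp: successively_Cons awalk_verts_ne_eq)
  qed (simp add: awalk_def)
  then show "successively adj (pawalk_verts u q)" "hd (pawalk_verts u q) = u"
    "last (pawalk_verts u q) = w" by blast+
qed

lemma circuit_of_cycle:
  assumes "cycle q" "3 \<le> length q"
  obtains p where "circuit p"
proof -
  obtain u where walk: "awalk u q u" and distinct: "distinct (tl (pawalk_verts u q))"
    using assms(1) by (auto simp: cycle_def)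
  obtain p where p: "pawalk_verts u q = u # p"
    using successively_pawalk_verts(2)[OF walk] by (cases "pawalk_verts u q") auto
  then have length: "length p = length q"
    using length_awalk_verts[of u q] by simp
  then have "p \<noteq> []" using assms(2) by auto
  then have "adj u (hd p)" "successively adj p" "last p = u"
    using successively_pawalk_verts[OF walk] by (simp_all add: p successively_Cons)
  then have "circuit p"
    using assms(2) distinct length by (auto simp: circuit_def p intro!: is_pathI)
  then show thesis by (rule that)
qed

lemma cycle_of_circuit:
  assumes "circuit p"
  obtains q where "cycle q" "3 \<le> length q"
proof -
  obtain a r where p: "p = a # r" and "r \<noteq> []"
    using assms by (cases p; cases "tl p") (auto simp: circuit_def)
  let ?w = "a # r @ [a]"
  have "successively adj ?w"
    using assms \<open>r \<noteq> []\<close>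
    by (auto simp: circuit_def p is_path_iff successively_append_iff successively_Cons)
  moreover have "a \<in> pverts G" using assms by (simp add: circuit_def p is_path_iff)
  ultimately have "awalk a (vwalk_arcs ?w) a" "pawalk_verts a (vwalk_arcs ?w) = ?w"
    using awalk_vwalk_arcs[of a "r @ [a]"] by simp_all
  moreover have "length (vwalk_arcs ?w) = length p"
    using vwalk_length_simp[of ?w] unfolding vwalk_length_def by (simp add: p del: vwalk_arcs_Cons)
  ultimately show thesis
    using assms by (intro that[of "vwalk_arcs ?w"]) (auto simp: cycle_def circuit_def p is_path_iff)
qed

lemma undirected_tree_iff:
  "undirected_tree G \<longleftrightarrow> Digraph_Component.connected (with_proj G) \<and> (\<nexists>p. circuit p)"
  unfolding undirected_tree_def using circuit_of_cycle cycle_of_circuit pair_graph by metis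

lemma path_chord_circuit:
  assumes p: "is_path p" and "i + 2 \<le> j" "j < length p" "adj (p ! i) (p ! j)"
  shows "circuit (take (Suc j - i) (drop i p))" (is "circuit ?q")
proof -
  have "length ?q = Suc j - i" using assms by simp
  moreover from this have "hd ?q = p ! i" "last ?q = p ! j"
    using assms by (simp_all add: hd_drop_conv_nth hd_take last_conv_nth)
  ultimately show ?thesis
    using assms adj_commute by (auto simp: circuit_def intro!: is_path_take is_path_drop)
qed

subsection \<open>Small forbidden configurations\<close>

lemma card_H3_Int_independent:
  assumes "e \<in> H3 G" and indep: "\<And>u v. u \<in> D \<Longrightarrow> v \<in> D \<Longrightarrow> \<not> adj u v"
  shows "card (e \<inter> D) \<le> 2"
proof -
  obtain a b c d where e: "e = {a, b, c, d}" "adj a b" "adj c d"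
    using H3E[OF assms(1)] by metis
  have "card (e \<inter> D) = card ({a, b} \<inter> D \<union> {c, d} \<inter> D)"
    by (rule arg_cong[where f = card]) (auto simp: e(1))
  also have "\<dots> \<le> card ({a, b} \<inter> D) + card ({c, d} \<inter> D)" by (rule card_Un_le)
  also have "card ({a, b} \<inter> D) \<le> 1" "card ({c, d} \<inter> D) \<le> 1"
    using indep e(2,3) by (auto simp: Int_insert_left card_insert_if)
  then have "card ({a, b} \<inter> D) + card ({c, d} \<inter> D) \<le> 2" by linarith
  finally show ?thesis .
qed

lemma not_mengerian_triangle_minor:
  assumes "distinct [x, y, z]" "{x, y, z} \<inter> D = {}" "{x, y, z} \<union> D \<subseteq> pverts G"
    and few: "\<And>e. e \<in> H3 G \<Longrightarrow> card (e \<inter> D) \<le> 2"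
    and edges: "A \<in> H3 G" "A \<subseteq> {x, y} \<union> D" "B \<in> H3 G" "B \<subseteq> {y, z} \<union> D" "C \<in> H3 G" "C \<subseteq> {x, z} \<union> D"
  shows "\<not> mengerian (pverts G) (H3 G)"
proof -
  have three: "{..<3::nat} = {0, 1, 2}" and two: "{..<2::nat} = {0, 1}" by auto
  define u where "u = (!) [x, y, z]"
  have U: "u ` {..<3} = {x, y, z}" by (simp add: three u_def insert_commute)
  show ?thesis
  proof (rule not_mengerian_cyclic_minor[where u = u and n = 3 and k = 2 and D = D], unfold U)
    show "inj_on u {..<3}" using assms(1) by (auto simp: three u_def)
    fix i :: nat assume "i < 3"
    then consider "i = 0" | "i = 1" | "i = 2" by linarith
    then show "\<exists>e\<in>H3 G. e \<subseteq> {x, y, z} \<union> D \<and> e \<inter> {x, y, z} \<subseteq> (\<lambda>t. u ((i + t) mod 3)) ` {..<2}"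
    proof cases
      case 1
      with edges(1,2) assms(2) show ?thesis by (intro bexI[of _ A]) (auto simp: two u_def)
    next
      case 2
      with edges(3,4) assms(2) show ?thesis by (intro bexI[of _ B]) (auto simp: two u_def)
    next
      case 3
      with edges(5,6) assms(2) show ?thesis by (intro bexI[of _ C]) (auto simp: two u_def)
    qed
  next
    fix e assume e: "e \<in> H3 G" "e \<subseteq> {x, y, z} \<union> D"
    then have "card e \<le> card (e \<inter> {x, y, z}) + card (e \<inter> D)"
      by (metis Int_Un_distrib card_Un_le inf.absorb_iff1)
    then show "2 \<le> card (e \<inter> {x, y, z})" using card_H3[OF e(1)] few[OF e(1)] by linarith
  qed (use assms(2,3) H3_subset_Pow pair_finite_verts in auto)
qed

lemma not_mengerian_five_set:
  assumes "distinct [x, y, z, a, b]"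
    and edges: "{x, y, a, b} \<in> H3 G" "{y, z, a, b} \<in> H3 G" "{x, z, a, b} \<in> H3 G"
  shows "\<not> mengerian (pverts G) (H3 G)"
proof (rule not_mengerian_triangle_minor[of x y z "{a, b}"
      "{x, y, a, b}" "{y, z, a, b}" "{x, z, a, b}"])
  fix e
  have "card (e \<inter> {a, b}) \<le> card {a, b}" by (intro card_mono) auto
  then show "card (e \<inter> {a, b}) \<le> 2" using assms(1) by simp
qed (use assms H3_subset_Pow in auto)

text \<open>The path \<open>x' x w y y'\<close> with \<open>z\<close> attached to \<open>w\<close>; contracting the independent set \<open>{w, x', y'}\<close>
  leaves a triangle.\<close>

lemma not_mengerian_spider:
  assumes dist: "distinct [x', x, w, y, y', z]"
    and edges: "adj x' x" "adj x w" "adj w y" "adj y y'" "adj w z"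
    and indep: "\<not> adj w x'" "\<not> adj w y'" "\<not> adj x' y'"
  shows "\<not> mengerian (pverts G) (H3 G)"
proof (rule not_mengerian_triangle_minor[of x y z "{w, x', y'}"])
  show "card (e \<inter> {w, x', y'}) \<le> 2" if "e \<in> H3 G" for e
    using indep adj_commute by (intro card_H3_Int_independent[OF that]) auto
  show "{x', x, w, y} \<in> H3 G" "{z, w, y, y'} \<in> H3 G" "{x', x, w, z} \<in> H3 G"
    using dist edges adj_commute by (intro H3I; auto)+
qed (use dist edges in \<open>auto dest: in_arcsD1 in_arcsD2\<close>)

lemma not_mengerian_C4_pendant:
  assumes "distinct [a, b, c, d, e]"
    and edges: "adj a b" "adj b c" "adj c d" "adj d a" "adj a e"
  shows "\<not> mengerian (pverts G) (H3 G)"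
proof (rule not_mengerian_five_set[of b d e a c])
  have "{a, b, c, d} \<in> H3 G" "{e, a, b, c} \<in> H3 G" "{e, a, d, c} \<in> H3 G"
    using assms adj_commute by (intro H3I; auto)+
  then show "{b, d, a, c} \<in> H3 G" "{b, e, a, c} \<in> H3 G" "{d, e, a, c} \<in> H3 G"
    by (simp_all add: insert_commute)
qed (use assms in auto)

lemma not_mengerian_bull:
  assumes "distinct [a, b, c, d, e]"
    and edges: "adj a b" "adj b c" "adj c a" "adj a d" "adj b e"
  shows "\<not> mengerian (pverts G) (H3 G)"
proof (rule not_mengerian_five_set[of c d e a b])
  have "{d, a, b, e} \<in> H3 G" "{d, a, c, b} \<in> H3 G" "{e, b, c, a} \<in> H3 G"
    using assms adj_commute by (intro H3I; auto)+
  then show "{c, d, a, b} \<in> H3 G" "{d, e, a, b} \<in> H3 G" "{c, e, a, b} \<in> H3 G"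
    by (simp_all add: insert_commute)
qed (use assms in auto)

lemma not_mengerian_triangle_tail:
  assumes "distinct [a, b, c, d, e]"
    and edges: "adj a b" "adj b c" "adj c a" "adj c d" "adj d e"
  shows "\<not> mengerian (pverts G) (H3 G)"
proof (rule not_mengerian_five_set[of a b e c d])
  have "{a, b, c, d} \<in> H3 G" "{a, c, d, e} \<in> H3 G" "{b, c, d, e} \<in> H3 G"
    using assms adj_commute by (intro H3I; auto)+
  then show "{a, b, c, d} \<in> H3 G" "{b, e, c, d} \<in> H3 G" "{a, e, c, d} \<in> H3 G"
    by (simp_all add: insert_commute)
qed (use assms in auto)

subsection \<open>Layered graphs\<close>

lemma H3_layered:
  fixes pos :: "'a \<Rightarrow> nat"
  assumes adj_iff: "\<And>u v. u \<in> pverts G \<Longrightarrow> v \<in> pverts G \<Longrightarrow>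
      adj u v \<longleftrightarrow> pos u = Suc (pos v) \<or> pos v = Suc (pos u)"
    and same_layer: "\<And>u v a b. u \<in> pverts G \<Longrightarrow> v \<in> pverts G \<Longrightarrow> u \<noteq> v \<Longrightarrow> pos u = pos v \<Longrightarrow>
      adj u a \<Longrightarrow> adj u b \<Longrightarrow> a = b"
  shows "H3 G = layer_transversals 4 (pverts G) pos"
proof (intro equalityI subsetI)
  fix e assume e: "e \<in> H3 G"
  obtain a b c d where p: "e = {a, b, c, d}" "adj a b" "adj b c" "adj c d" "distinct [a, b, c, d]"
    using H3E[OF e] .
  have V: "a \<in> pverts G" "b \<in> pverts G" "c \<in> pverts G" "d \<in> pverts G"
    using p(2-4) by (auto dest: in_arcsD1 in_arcsD2)
  have ac: "pos a \<noteq> pos c" using same_layer[OF V(3,1), of b d] p adj_commute by auto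
  have bd: "pos b \<noteq> pos d" using same_layer[OF V(2,4), of a c] p adj_commute by auto
  have steps: "pos a = Suc (pos b) \<or> pos b = Suc (pos a)"
      "pos b = Suc (pos c) \<or> pos c = Suc (pos b)"
      "pos c = Suc (pos d) \<or> pos d = Suc (pos c)"
    using p(2-4) adj_iff V by blast+
  have "\<exists>p q r s. e = {p, q, r, s} \<and> pos q = pos p + 1 \<and> pos r = pos p + 2 \<and> pos s = pos p + 3"
  proof (cases "pos b = Suc (pos a)")
    case True
    then have "pos b = pos a + 1" "pos c = pos a + 2" "pos d = pos a + 3"
      using steps ac bd by linarith+
    then show ?thesis using p(1) by blast
  next
    case False
    then have "pos c = pos d + 1" "pos b = pos d + 2" "pos a = pos d + 3"
      using steps ac bd by linarith+
    moreover have "e = {d, c, b, a}" using p(1) by (simp add: insert_commute)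
    ultimately show ?thesis by blast
  qed
  then show "e \<in> layer_transversals 4 (pverts G) pos"
    using e H3_subset_Pow unfolding layer_transversals_4_iff by blast
next
  fix e assume "e \<in> layer_transversals 4 (pverts G) pos"
  then obtain a b c d where e: "e = {a, b, c, d}" "e \<subseteq> pverts G"
    and pos: "pos b = pos a + 1" "pos c = pos a + 2" "pos d = pos a + 3"
    unfolding layer_transversals_4_iff by blast
  have "{a, b, c, d} \<in> H3 G"
    using e pos adj_iff by (intro H3I) auto
  then show "e \<in> H3 G" using e(1) by simp
qed

lemma mengerian_four_vertices:
  assumes "card (pverts G) = 4"
  shows "mengerian (pverts G) (H3 G)"
proof (cases "H3 G = {}")
  case True
  have "integral_cover (pverts G) {} (\<lambda>_. 0)" "integral_packing (pverts G) {} c (\<lambda>_. 0)" for c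
    by (simp_all add: integral_cover_def integral_packing_def)
  then show ?thesis unfolding True by (intro mengerianI) force
next
  case False
  have unique: "e = pverts G" if "e \<subseteq> pverts G" "card e = 4" for e
    using that assms pair_finite_verts by (metis card_subset_eq)
  obtain pos where pos: "bij_betw pos (pverts G) {0..<4::nat}"
    using ex_bij_betw_finite_nat[OF pair_finite_verts] assms by auto
  have "H3 G = {pverts G}" using False unique H3_subset_Pow card_H3 by blast
  also have "\<dots> = layer_transversals 4 (pverts G) pos"
  proof (intro equalityI subsetI)
    fix e assume "e \<in> layer_transversals 4 (pverts G) pos"
    then show "e \<in> {pverts G}"
      using unique[of e] bij_betw_same_card[of pos e] by (auto simp: layer_transversals_def)
  qed (use pos in \<open>auto simp: layer_transversals_def intro: exI[of _ 0]\<close>)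
  finally show ?thesis using mengerian_layer_transversals[OF pair_finite_verts] by simp
qed

subsection \<open>Stars with an extra edge\<close>

definition star_with_edge_at :: "'a \<Rightarrow> 'a \<Rightarrow> 'a \<Rightarrow> bool" where
  "star_with_edge_at c a b \<longleftrightarrow> distinct [a, b, c] \<and> {a, b, c} \<subseteq> pverts G \<and>
     parcs G = {(a, b), (b, a)} \<union> {c} \<times> (pverts G - {c}) \<union> (pverts G - {c}) \<times> {c}"

lemma star_with_extra_edgeE:
  assumes "star_with_extra_edge G"
  obtains c a b where "star_with_edge_at c a b"
proof -
  obtain S n a b where S: "complete_bipartite_digraph 1 n (with_proj S)" "leaf S a" "leaf S b"
      "a \<noteq> b" "(a, b) \<notin> parcs S" "pverts G = pverts S" "parcs G = parcs S \<union> {(a, b), (b, a)}"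
    using assms unfolding star_with_extra_edge_def by blast
  obtain C L where CL: "pverts S = C \<union> L" "C \<inter> L = {}" "card C = 1" "parcs S = C \<times> L \<union> L \<times> C"
    using S(1) unfolding complete_bipartite_digraph_pair_def by blast
  obtain c where c: "C = {c}" using CL(3) by (auto simp: card_1_singleton_iff)
  have L: "L = pverts G - {c}" using CL(1,2) S(6) c by auto
  have "a \<in> pverts G" "b \<in> pverts G" using S(2,3,6) by (auto simp: leaf_def)
  moreover have "a \<noteq> c" "b \<noteq> c"
    using calculation S(4,5) CL(4) by (auto simp: c L)
  moreover have "c \<in> pverts G" using CL(1) S(6) c by simp
  ultimately show thesis
    using S(4,7) CL(4) by (intro that[of c a b]) (auto simp: star_with_edge_at_def c L)
qed

lemma star_with_extra_edgeI:
  assumes "star_with_edge_at c a b"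
  shows "star_with_extra_edge G"
proof -
  have ab: "a \<noteq> b" "a \<noteq> c" "b \<noteq> c" "a \<in> pverts G" "b \<in> pverts G" "c \<in> pverts G"
    and arcs: "parcs G = {(a, b), (b, a)} \<union> {c} \<times> (pverts G - {c}) \<union> (pverts G - {c}) \<times> {c}"
    using assms by (auto simp: star_with_edge_at_def)
  let ?L = "pverts G - {c}"
  define S where "S = \<lparr>pverts = pverts G, parcs = {c} \<times> ?L \<union> ?L \<times> {c}\<rparr>"
  have "complete_bipartite_digraph 1 (card ?L) (with_proj S)"
    unfolding complete_bipartite_digraph_pair_def S_def
    by (rule conjI, use pair_finite_verts in simp, rule exI[of _ "{c}"], rule exI[of _ ?L])
      (use ab in auto)
  moreover have "leaf S v" if "v \<in> ?L" for v
  proof -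
    have "out_arcs (with_proj S) v = {(v, c)}" using that ab(6) by (auto simp: S_def out_arcs_def)
    then show ?thesis using that by (simp add: leaf_def out_degree_def S_def)
  qed
  moreover have "parcs G = parcs S \<union> {(a, b), (b, a)}"
    using arcs by (auto simp: S_def)
  ultimately show ?thesis
    unfolding star_with_extra_edge_def
    using ab by (intro exI[of _ S] exI[of _ "card ?L"] exI[of _ a] exI[of _ b]) (simp add: S_def)
qed

lemma star_with_edge_H3:
  assumes "star_with_edge_at c a b"
  shows "e \<in> H3 G \<longleftrightarrow> (\<exists>z\<in>pverts G - {a, b, c}. e = {c, a, b, z})"
proof -
  have ab: "distinct [a, b, c]" "{a, b, c} \<subseteq> pverts G"
    and arcs: "parcs G = {(a, b), (b, a)} \<union> {c} \<times> (pverts G - {c}) \<union> (pverts G - {c}) \<times> {c}"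
    using assms by (simp_all add: star_with_edge_at_def)
  show ?thesis
  proof
    assume e: "e \<in> H3 G"
    then obtain p q r s where "e = {p, q, r, s}" "adj p q" "adj q r" "adj r s" "distinct [p, q, r, s]"
      by (rule H3E)
    then have sub: "{c, a, b} \<subseteq> e" using ab unfolding arcs by auto
    moreover have "card {c, a, b} = 3" using ab(1) by auto
    ultimately have "card (e - {c, a, b}) = 1" using card_H3[OF e] by (simp add: card_Diff_subset)
    then obtain z where "e - {c, a, b} = {z}" by (auto simp: card_1_singleton_iff)
    moreover have "e \<subseteq> pverts G" using e H3_subset_Pow by blast
    ultimately show "\<exists>z\<in>pverts G - {a, b, c}. e = {c, a, b, z}"
      using sub by (intro bexI[of _ z]) blast+
  next
    assume "\<exists>z\<in>pverts G - {a, b, c}. e = {c, a, b, z}"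
    then obtain z where z: "z \<in> pverts G - {a, b, c}" "e = {c, a, b, z}" by blast
    have "adj z c" "adj c a" "adj a b" using z(1) ab by (auto simp: arcs)
    then have "{z, c, a, b} \<in> H3 G" using z(1) ab by (intro H3I) auto
    then show "e \<in> H3 G" by (simp add: z(2) insert_commute)
  qed
qed

lemma star_with_extra_edge_imp_mengerian:
  assumes "star_with_extra_edge G"
  shows "mengerian (pverts G) (H3 G)"
proof -
  obtain c a b where star: "star_with_edge_at c a b" using assms by (rule star_with_extra_edgeE)
  then have ab: "distinct [a, b, c]" "{a, b, c} \<subseteq> pverts G" by (simp_all add: star_with_edge_at_def)
  define pos where "pos v = (if v = c then 0 else if v = a then 1 else if v = b then 2 else 3 :: nat)"
    for v
  have "e \<in> H3 G \<longleftrightarrow> e \<in> layer_transversals 4 (pverts G) pos" for e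
    unfolding star_with_edge_H3[OF star] layer_transversals_4_iff
  proof
    assume "\<exists>z\<in>pverts G - {a, b, c}. e = {c, a, b, z}"
    then obtain z where "z \<in> pverts G - {a, b, c}" "e = {c, a, b, z}" by blast
    then show "e \<subseteq> pverts G \<and> (\<exists>p q r s. e = {p, q, r, s} \<and>
        pos q = pos p + 1 \<and> pos r = pos p + 2 \<and> pos s = pos p + 3)"
      using ab by (intro conjI exI[of _ c] exI[of _ a] exI[of _ b] exI[of _ z]) (auto simp: pos_def)
  next
    assume "e \<subseteq> pverts G \<and> (\<exists>p q r s. e = {p, q, r, s} \<and>
        pos q = pos p + 1 \<and> pos r = pos p + 2 \<and> pos s = pos p + 3)"
    then obtain p q r z where e: "e = {p, q, r, z}" "e \<subseteq> pverts G"
      and pos: "pos q = pos p + 1" "pos r = pos p + 2" "pos z = pos p + 3" by blast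
    moreover have "pos z \<le> 3" by (simp add: pos_def)
    ultimately have "pos p = 0" "pos q = 1" "pos r = 2" "pos z = 3" by linarith+
    then have "p = c" "q = a" "r = b" "z \<notin> {a, b, c}" by (auto simp: pos_def split: if_splits)
    then show "\<exists>z\<in>pverts G - {a, b, c}. e = {c, a, b, z}" using e by auto
  qed
  then have "H3 G = layer_transversals 4 (pverts G) pos" by blast
  then show ?thesis using mengerian_layer_transversals[OF pair_finite_verts] by simp
qed

end

subsection \<open>Induced cycles\<close>

lemma quasiperiodic_mult:
  fixes p :: "int \<Rightarrow> int"
  assumes "\<And>i. p (i + a) = p i + b"
  shows "p (i + a * m) = p i + b * m"
proof (induction m rule: int_induct[where k = 0])
  case (step1 m)
  then show ?case using assms[of "i + a * m"] by (simp add: algebra_simps)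
next
  case (step2 m)
  then show ?case using assms[of "i + a * (m - 1)"] by (simp add: algebra_simps)
qed simp

lemma strict_mono_intI:
  fixes p :: "int \<Rightarrow> int"
  assumes "\<And>i. p i < p (i + 1)"
  shows "strict_mono p"
proof (rule strict_monoI)
  fix i j :: int assume "i < j"
  then show "p i < p j" by (induction j rule: int_gr_induct) (auto intro: assms less_trans)
qed

lemma strict_mono_int_crossing:
  fixes p :: "int \<Rightarrow> int"
  assumes "strict_mono p"
  obtains j where "p (j - 1) < s" "s \<le> p j"
proof -
  have "\<exists>j. p (j - 1) < s \<and> s \<le> p j"
  proof (induction s rule: int_induct[where k = "p 0"])
    case base
    show ?case using strict_monoD[OF assms, of "- 1" 0] by (intro exI[of _ 0]) simp
  next
    case (step1 s)
    then obtain j where "p (j - 1) < s" "s \<le> p j" by blast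
    moreover have "p j < p (j + 1)" using strict_monoD[OF assms] by simp
    ultimately show ?case by (cases "s = p j") (auto intro: exI[of _ j] exI[of _ "j + 1"])
  next
    case (step2 s)
    then obtain j where "p (j - 1) < s" "s \<le> p j" by blast
    moreover have "p (j - 1 - 1) < p (j - 1)" using strict_monoD[OF assms] by simp
    ultimately show ?case by (cases "p (j - 1) < s - 1") (auto intro: exI[of _ j] exI[of _ "j - 1"])
  qed
  then show thesis using that by blast
qed

text \<open>The sequence \<open>2, 3, 5, 7, 8, 10, 12, \<dots>, 2 N - 2\<close> continued periodically: the quotients count the
  gaps of length 1, which are so far apart that no two of them occur among three consecutive gaps.\<close>

definition thinned_position :: "int \<Rightarrow> int \<Rightarrow> int" where
  "thinned_position N i = 2 * i - (i - 1) div N - (i - 4) div N"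

lemma thinned_position_gaps:
  assumes "6 \<le> N"
  shows "thinned_position N i < thinned_position N (i + 1)"
    and "thinned_position N (i + 1) \<le> thinned_position N i + 2"
    and "thinned_position N i + 5 \<le> thinned_position N (i + 3)"
    and "thinned_position N (i + N) = thinned_position N i + (2 * N - 2)"
proof -
  have div_le: "i div N \<le> (i - 6) div N + 1" for i
  proof -
    have "i div N \<le> (i - 6 + N) div N" using assms by (intro zdiv_mono1) auto
    then show ?thesis using assms by simp
  qed
  have mono: "i div N \<le> j div N" if "i \<le> j" for i j using that assms by (intro zdiv_mono1) auto
  show "thinned_position N i < thinned_position N (i + 1)"
    using div_le[of i] mono[of "i - 6" "i - 4"] mono[of "i - 3" "i - 1"]
    by (simp add: thinned_position_def)
  show "thinned_position N (i + 1) \<le> thinned_position N i + 2"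
    using mono[of "i - 1" i] mono[of "i - 4" "i - 3"] by (simp add: thinned_position_def)
  show "thinned_position N i + 5 \<le> thinned_position N (i + 3)"
    using div_le[of "i + 2"] by (simp add: thinned_position_def add.commute)
  have "(i + N - a) div N = (i - a) div N + 1" for a
    using assms div_add_self2[of N "i - a"] by (simp add: algebra_simps)
  then show "thinned_position N (i + N) = thinned_position N i + (2 * N - 2)"
    by (simp add: thinned_position_def algebra_simps)
qed

lemma digraph_iso_pairE:
  assumes "pair_wf_digraph G" "digraph_iso (with_proj G) (with_proj H)"
  obtains h where "bij_betw h (pverts G) (pverts H)"
    "\<And>u v. u \<in> pverts G \<Longrightarrow> v \<in> pverts G \<Longrightarrow> (u, v) \<in> parcs G \<longleftrightarrow> (h u, h v) \<in> parcs H"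
proof -
  interpret G: pair_wf_digraph G by fact
  obtain f where f: "G.digraph_isomorphism f" "with_proj H = app_iso f (with_proj G)"
    using assms(2) unfolding digraph_iso_def by blast
  let ?h = "iso_verts f"
  have inj: "inj_on ?h (pverts G)" using G.digraph_isomorphism_inj_on_verts[OF f(1)] by simp
  moreover have "?h ` pverts G = pverts H" using arg_cong[OF f(2), of verts] by simp
  ultimately have bij: "bij_betw ?h (pverts G) (pverts H)" by (simp add: bij_betw_def)
  have arcs: "parcs H = (\<lambda>(u, v). (?h u, ?h v)) ` parcs G"
    using G.arcs_ends_app_iso_eq[OF f(1)] arg_cong[OF f(2), of arcs_ends] by simp
  have "(u, v) \<in> parcs G \<longleftrightarrow> (?h u, ?h v) \<in> parcs H" if "u \<in> pverts G" "v \<in> pverts G" for u v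
  proof
    assume "(?h u, ?h v) \<in> parcs H"
    then obtain a b where "(a, b) \<in> parcs G" "?h u = ?h a" "?h v = ?h b" using arcs by auto
    moreover from this(1) have "a \<in> pverts G" "b \<in> pverts G" by (rule G.in_arcsD1, rule G.in_arcsD2)
    ultimately show "(u, v) \<in> parcs G" using that inj by (simp add: inj_on_eq_iff)
  qed (use arcs in force)
  with bij show thesis by (rule that)
qed

lemma digraph_iso_pairI:
  assumes "pair_wf_digraph G" "pair_wf_digraph H" and bij: "bij_betw h (pverts G) (pverts H)"
    and arcs: "\<And>u v. u \<in> pverts G \<Longrightarrow> v \<in> pverts G \<Longrightarrow> (u, v) \<in> parcs G \<longleftrightarrow> (h u, h v) \<in> parcs H"
  shows "digraph_iso (with_proj G) (with_proj H)"
proof -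
  interpret G: pair_wf_digraph G by fact
  interpret H: pair_wf_digraph H by fact
  define f where "f = \<lparr>iso_verts = h, iso_arcs = map_prod h h, iso_head = snd, iso_tail = fst\<rparr>"
  have sub: "parcs G \<subseteq> pverts G \<times> pverts G" "parcs H \<subseteq> h ` pverts G \<times> h ` pverts G"
    using bij by (auto simp: bij_betw_def dest: G.in_arcsD1 G.in_arcsD2 H.in_arcsD1 H.in_arcsD2)
  have "inj_on (map_prod h h) (parcs G)"
    using map_prod_inj_on[of h "pverts G" h "pverts G"] bij sub(1)
    by (auto simp: bij_betw_def intro: inj_on_subset)
  then have "G.digraph_isomorphism f"
    using bij G.wf_digraph unfolding G.digraph_isomorphism_def by (auto simp: f_def bij_betw_def)
  moreover have "map_prod h h ` parcs G = parcs H"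
  proof (intro equalityI subsetI)
    fix e assume "e \<in> parcs H"
    moreover from this obtain a b where "e = (h a, h b)" "a \<in> pverts G" "b \<in> pverts G"
      using sub(2) by blast
    ultimately show "e \<in> map_prod h h ` parcs G"
      using arcs by (auto intro: image_eqI[of _ _ "(a, b)"])
  qed (use arcs sub(1) in auto)
  then have "with_proj H = app_iso f (with_proj G)"
    using bij by (intro pre_digraph.equality) (simp_all add: f_def bij_betw_def)
  ultimately show ?thesis unfolding digraph_iso_def by blast
qed

lemma pair_wf_digraph_cycle_graph: "pair_wf_digraph (cycle_graph n)"
  by unfold_locales (auto simp: cycle_graph_def)

lemma parcs_cycle_graph_iff:
  "a < n \<Longrightarrow> b < n \<Longrightarrow> (a, b) \<in> parcs (cycle_graph n) \<longleftrightarrow> b = Suc a mod n \<or> a = Suc b mod n"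
  by (simp add: cycle_graph_def)

context pair_graph
begin

text \<open>The vertices of the cycle are indexed by all integers, periodically modulo its length \<open>n\<close>.\<close>

definition induced_cycle :: "int \<Rightarrow> (int \<Rightarrow> 'a) \<Rightarrow> bool" where
  "induced_cycle n v \<longleftrightarrow> (\<forall>i j. v i = v j \<longleftrightarrow> i mod n = j mod n) \<and>
     (\<forall>i j. adj (v i) (v j) \<longleftrightarrow> v j = v (i + 1) \<or> v i = v (j + 1))"

lemma induced_cycle_eq_iff: "induced_cycle n v \<Longrightarrow> v i = v j \<longleftrightarrow> n dvd i - j"
  by (simp add: induced_cycle_def mod_eq_dvd_iff)

lemma induced_cycle_adj_iff:
  assumes "induced_cycle n v"
  shows "adj (v i) (v j) \<longleftrightarrow> n dvd j - i - 1 \<or> n dvd i - j - 1"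
proof -
  have "adj (v i) (v j) \<longleftrightarrow> v j = v (i + 1) \<or> v i = v (j + 1)"
    using assms by (simp add: induced_cycle_def)
  then show ?thesis by (simp add: induced_cycle_eq_iff[OF assms] algebra_simps)
qed

lemma induced_cycle_range: "induced_cycle n v \<Longrightarrow> range v \<subseteq> pverts G"
proof clarify
  fix i
  assume "induced_cycle n v"
  then have "adj (v i) (v (i + 1))" by (simp add: induced_cycle_def)
  then show "v i \<in> pverts G" by (rule in_arcsD1)
qed

lemma induced_cycle_neq:
  assumes "induced_cycle n v" "i < j" "j < i + n"
  shows "v i \<noteq> v j"
  using assms zdvd_not_zless[of "j - i" n] by (simp add: induced_cycle_eq_iff dvd_diff_commute)

lemma induced_cycle_adj_range:
  assumes "induced_cycle n v" "adj (v i) w" "w \<in> range v"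
  shows "w = v (i + 1) \<or> w = v (i - 1)"
proof -
  obtain j where w: "w = v j" using assms(3) by blast
  have "n dvd j - (i + 1) \<or> n dvd (i - 1) - j"
    using assms(2) by (simp add: w induced_cycle_adj_iff[OF assms(1)] algebra_simps)
  then show ?thesis
    by (auto simp: w induced_cycle_eq_iff[OF assms(1)] dvd_diff_commute)
qed

lemma induced_cycle_window_H3:
  assumes "induced_cycle n v" "5 \<le> n"
  shows "v ` {s..s + 3} \<in> H3 G"
  unfolding image_int_window
proof (rule H3I)
  show "adj (v s) (v (s + 1))" "adj (v (s + 1)) (v (s + 2))" "adj (v (s + 2)) (v (s + 3))"
    using assms by (simp_all add: induced_cycle_adj_iff)
  show "distinct [v s, v (s + 1), v (s + 2), v (s + 3)]"
    using assms by (simp add: induced_cycle_neq)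
qed

lemma induced_cycle_H3_window:
  assumes cyc: "induced_cycle n v" and e: "e \<in> H3 G" "e \<subseteq> range v"
  obtains s where "e = v ` {s..s + 3}"
proof -
  obtain a b c d where p: "e = {a, b, c, d}" "adj a b" "adj b c" "adj c d" "distinct [a, b, c, d]"
    using H3E[OF e(1)] .
  note step = induced_cycle_adj_range[OF cyc]
  obtain i where i: "a = v i" using e(2) p(1) by auto
  have "b = v (i + 1) \<or> b = v (i - 1)" using step[of i b] p e(2) i by auto
  then show thesis
  proof
    assume b: "b = v (i + 1)"
    have c: "c = v (i + 2)" using step[of "i + 1" c] p e(2) i b by (auto simp: add.commute)
    have "d = v (i + 3)" using step[of "i + 2" d] p e(2) b c by (auto simp: add.commute)
    then show thesis using that[of i] p(1) i b c unfolding image_int_window by auto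
  next
    assume b: "b = v (i - 1)"
    have c: "c = v (i - 2)" using step[of "i - 1" c] p e(2) i b by (auto simp: add.commute)
    have "d = v (i - 3)" using step[of "i - 2" d] p e(2) b c by (auto simp: add.commute)
    then show thesis using that[of "i - 3"] p(1) i b c unfolding image_int_window by auto
  qed
qed

lemma induced_cycleI:
  assumes "0 < n" and inj: "inj_on g {..<n}"
    and adj_iff: "\<And>a b. a < n \<Longrightarrow> b < n \<Longrightarrow> adj (g a) (g b) \<longleftrightarrow> b = Suc a mod n \<or> a = Suc b mod n"
  shows "induced_cycle (int n) (\<lambda>k. g (nat (k mod int n)))"
proof -
  define r where "r k = nat (k mod int n)" for k
  have r: "r k < n" "int (r k) = k mod int n" for k
    using assms(1) by (simp_all add: r_def nat_less_iff)
  have r_Suc: "r (k + 1) = Suc (r k) mod n" for k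
  proof -
    have "int (r (k + 1)) = int (Suc (r k) mod n)"
      by (simp add: r(2) of_nat_mod mod_simps add.commute)
    then show ?thesis by simp
  qed
  have eq_iff: "g (r i) = g (r j) \<longleftrightarrow> r i = r j" for i j
    using inj r(1) by (simp add: inj_on_eq_iff)
  moreover have "r i = r j \<longleftrightarrow> i mod int n = j mod int n" for i j
    by (metis r(2) of_nat_eq_iff)
  moreover have "adj (g (r i)) (g (r j)) \<longleftrightarrow> r j = r (i + 1) \<or> r i = r (j + 1)" for i j
    unfolding r_Suc by (rule adj_iff[OF r(1) r(1)])
  ultimately show ?thesis unfolding induced_cycle_def r_def by simp
qed

lemma induced_cycle_subsequence:
  fixes p :: "int \<Rightarrow> int"
  assumes cyc: "induced_cycle n v" and p: "strict_mono p" "\<And>i. p (i + int N) = p i + n" and "0 < N"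
  shows "v (p i) = v (p (i mod int N))"
    and "v ` range p = (\<lambda>i. v (p (int i))) ` {..<N}"
    and "inj_on (\<lambda>i. v (p (int i))) {..<N}"
    and "v r \<in> v ` range p \<Longrightarrow> r \<in> range p"
proof -
  note p_add = quasiperiodic_mult[of p "int N" n, OF p(2)]
  show mod: "v (p i) = v (p (i mod int N))" for i
  proof -
    have "p i = p (i mod int N) + n * (i div int N)"
      using p_add[of "i mod int N" "i div int N"] by simp
    then show ?thesis by (simp add: induced_cycle_eq_iff[OF cyc])
  qed
  have "v (p i) = v (p (int (nat (i mod int N))))" "nat (i mod int N) < N" for i
    using assms(4) mod[of i] by (simp_all add: nat_less_iff)
  then show "v ` range p = (\<lambda>i. v (p (int i))) ` {..<N}" by blast
  show "inj_on (\<lambda>i. v (p (int i))) {..<N}"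
  proof (rule linorder_inj_onI')
    fix i j assume "i \<in> {..<N}" "j \<in> {..<N}" "i < j"
    then have "p (int i) < p (int j)" "p (int j) < p (int i + int N)"
      using strict_monoD[OF p(1)] by auto
    then show "v (p (int i)) \<noteq> v (p (int j))" unfolding p(2) by (rule induced_cycle_neq[OF cyc])
  qed
  assume "v r \<in> v ` range p"
  then obtain j where "n dvd r - p j" using induced_cycle_eq_iff[OF cyc] by blast
  then obtain m where "r = p j + n * m" by (metis add.commute diff_eq_eq dvdE)
  then show "r \<in> range p" using p_add[of j m] by (metis rangeI)
qed

lemma window_meets_sparse_subsequence:
  fixes p :: "int \<Rightarrow> int"
  assumes cyc: "induced_cycle n v" and p: "strict_mono p" "\<And>i. p (i + int N) = p i + n" "0 < N"
    and s: "p (i - 1) < s" "s + 3 < p (i + int k)"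
  shows "v ` {s..s + 3} \<inter> v ` range p \<subseteq> (\<lambda>t. v (p (i + int t))) ` {..<k}"
proof
  fix w assume w: "w \<in> v ` {s..s + 3} \<inter> v ` range p"
  then obtain r where r: "w = v r" "r \<in> {s..s + 3}" by blast
  then obtain j where j: "r = p j" using induced_cycle_subsequence(4)[OF cyc p] w by blast
  then have "p (i - 1) < p j" "p j < p (i + int k)" using s r(2) by auto
  then have "i \<le> j" "j < i + int k" using strict_mono_less[OF p(1)] by auto
  then have "j = i + int (nat (j - i))" "nat (j - i) < k" by auto
  then show "w \<in> (\<lambda>t. v (p (i + int t))) ` {..<k}"
    using r(1) j by (intro image_eqI[of _ _ "nat (j - i)"]) auto
qed

lemma window_meets_dense_subsequence:
  fixes p :: "int \<Rightarrow> int"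
  assumes cyc: "induced_cycle n v" "5 \<le> n" and p: "strict_mono p"
    and j: "s \<le> p j" "p (j + int k - 1) \<le> s + 3"
  shows "k \<le> card (v ` {s..s + 3} \<inter> v ` range p)"
proof -
  let ?J = "{j..<j + int k}"
  have between: "s \<le> p i \<and> p i \<le> s + 3" if "i \<in> ?J" for i
  proof -
    have "p j \<le> p i" "p i \<le> p (j + int k - 1)" using that strict_mono_less_eq[OF p] by auto
    then show ?thesis using j by linarith
  qed
  have "inj_on (\<lambda>i. v (p i)) ?J"
  proof (rule linorder_inj_onI')
    fix i i' assume "i \<in> ?J" "i' \<in> ?J" "i < i'"
    then show "v (p i) \<noteq> v (p i')"
      using between[of i] between[of i'] strict_monoD[OF p, of i i'] cyc(2)
      by (intro induced_cycle_neq[OF cyc(1)]) auto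
  qed
  then have "k = card ((\<lambda>i. v (p i)) ` ?J)" by (simp add: card_image)
  also have "\<dots> \<le> card (v ` {s..s + 3} \<inter> v ` range p)"
    using between by (intro card_mono) auto
  finally show ?thesis .
qed

text \<open>Only the vertices at positions in the range of \<open>p\<close> are kept, the others on the cycle being
  contracted; the windows then become the edges of a circular structure on \<open>N\<close> vertices.\<close>

lemma not_mengerian_induced_cycle_subsequence:
  fixes p :: "int \<Rightarrow> int"
  assumes cyc: "induced_cycle n v" "5 \<le> n"
    and p: "strict_mono p" "\<And>i. p (i + int N) = p i + n"
    and k: "0 < k" "\<not> k dvd N"
    and dense: "\<And>s. \<exists>j. s \<le> p j \<and> p (j + int k - 1) \<le> s + 3"
    and sparse: "\<And>i. \<exists>s. p (i - 1) < s \<and> s + 3 < p (i + int k)"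
  shows "\<not> mengerian (pverts G) (H3 G)"
proof -
  have "0 < N" using k(2) by (cases N) auto
  note sub = induced_cycle_subsequence[where p = p and N = N, OF cyc(1) p this]
  let ?u = "\<lambda>i. v (p (int i))" and ?D = "range v - v ` range p"
  have U: "v ` range p \<union> ?D = range v" by auto
  show ?thesis
  proof (rule not_mengerian_cyclic_minor[where u = ?u and n = N and D = ?D and k = k],
      unfold U sub(2)[symmetric])
    show "inj_on ?u {..<N}" by (rule sub(3))
    fix i assume "i < N"
    obtain s where s: "p (int i - 1) < s" "s + 3 < p (int i + int k)" using sparse by blast
    have "v (p (int i + int t)) = ?u ((i + t) mod N)" for t
      using sub(1)[of "int i + int t"] by (simp add: of_nat_mod)
    then have "v ` {s..s + 3} \<inter> v ` range p \<subseteq> (\<lambda>t. ?u ((i + t) mod N)) ` {..<k}"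
      using window_meets_sparse_subsequence[OF cyc(1) p \<open>0 < N\<close> s] by simp
    then show "\<exists>e\<in>H3 G. e \<subseteq> range v \<and> e \<inter> v ` range p \<subseteq> (\<lambda>t. ?u ((i + t) mod N)) ` {..<k}"
      using induced_cycle_window_H3[OF cyc, of s] by (intro bexI[of _ "v ` {s..s + 3}"]) auto
  next
    fix e assume "e \<in> H3 G" "e \<subseteq> range v"
    then obtain s where "e = v ` {s..s + 3}" using induced_cycle_H3_window[OF cyc(1)] by blast
    then show "k \<le> card (e \<inter> v ` range p)"
      using dense window_meets_dense_subsequence[OF cyc p(1)] by blast
  qed (use induced_cycle_range[OF cyc(1)] k pair_finite_verts H3_subset_Pow in auto)
qed

lemma not_mengerian_induced_cycle_not_dvd_4:
  assumes cyc: "induced_cycle n v" "5 \<le> n" "\<not> 4 dvd n"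
  shows "\<not> mengerian (pverts G) (H3 G)"
proof (rule not_mengerian_induced_cycle_subsequence[OF cyc(1,2),
      where p = id and N = "nat n" and k = 4])
  show "\<not> 4 dvd nat n" using cyc(2,3) int_dvd_int_iff[of 4 "nat n"] by simp
  show "\<exists>j. s \<le> id j \<and> id (j + int 4 - 1) \<le> s + 3" for s by (intro exI[of _ s]) simp
  show "\<exists>s. id (i - 1) < s \<and> s + 3 < id (i + int 4)" for i by (intro exI[of _ i]) simp
qed (use cyc(2) in \<open>auto simp: strict_mono_def\<close>)

lemma not_mengerian_induced_cycle_dvd_4:
  assumes cyc: "induced_cycle n v" and n: "4 dvd n" "12 \<le> n"
  shows "\<not> mengerian (pverts G) (H3 G)"
proof -
  obtain q where q: "n = 4 * q" using n(1) by (elim dvdE)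
  define N where "N = 2 * q + 1"
  have N: "6 \<le> N" "n = 2 * N - 2" using n(2) by (simp_all add: q N_def)
  note p = thinned_position_gaps[OF N(1)]
  have strict: "strict_mono (thinned_position N)" using p(1) by (rule strict_mono_intI)
  show ?thesis
  proof (rule not_mengerian_induced_cycle_subsequence[OF cyc, where N = "nat N" and k = 2])
    show "\<not> 2 dvd nat N" using N(1) by (simp add: N_def even_nat_iff)
    show "thinned_position N (i + int (nat N)) = thinned_position N i + n" for i
      using p(4) N by simp
    fix s
    obtain j where "thinned_position N (j - 1) < s" "s \<le> thinned_position N j"
      using strict_mono_int_crossing[OF strict] .
    then show "\<exists>j. s \<le> thinned_position N j \<and> thinned_position N (j + int 2 - 1) \<le> s + 3"
      using p(2)[of "j - 1"] p(2)[of j] by (intro exI[of _ j]) (simp add: add.commute)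
    show "\<exists>s. thinned_position N (i - 1) < s \<and> s + 3 < thinned_position N (i + int 2)" for i
      using p(3)[of "i - 1"] by
        (intro exI[of _ "thinned_position N (i - 1) + 1"]) (simp add: algebra_simps)
  qed (use n(2) strict in auto)
qed

lemma induced_cycle_bij_betw:
  assumes "induced_cycle (int n) v" "0 < n"
  shows "bij_betw (\<lambda>i. v (int i)) {..<n} (range v)"
  using induced_cycle_subsequence(2,3)[OF assms(1), of id n] assms(2)
  by (simp add: strict_mono_def bij_betw_def)

lemma digraph_iso_cycle_graphE:
  assumes "digraph_iso (with_proj G) (with_proj (cycle_graph n))" "0 < n"
  obtains v where "induced_cycle (int n) v" "range v = pverts G"
proof -
  have "digraph_iso (with_proj (cycle_graph n)) (with_proj G)"
    using digraph_iso_swap[OF wf_digraph assms(1)] .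
  then obtain h where h: "bij_betw h {..<n} (pverts G)"
    and arcs: "\<And>a b. a < n \<Longrightarrow> b < n \<Longrightarrow> (a, b) \<in> parcs (cycle_graph n) \<longleftrightarrow> adj (h a) (h b)"
    using digraph_iso_pairE[OF pair_wf_digraph_cycle_graph] by (auto simp: cycle_graph_def)
  let ?v = "\<lambda>k. h (nat (k mod int n))"
  have cyc: "induced_cycle (int n) ?v"
    using h arcs parcs_cycle_graph_iff by (intro induced_cycleI assms(2)) (auto simp: bij_betw_def)
  moreover have "range ?v = pverts G"
    using bij_betw_imp_surj_on[OF induced_cycle_bij_betw[OF cyc assms(2)]] h
    by (simp add: bij_betw_def)
  ultimately show thesis by (rule that)
qed

lemma digraph_iso_cycle_graphI:
  assumes cyc: "induced_cycle (int n) v" "range v = pverts G" "0 < n"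
  shows "digraph_iso (with_proj G) (with_proj (cycle_graph n))"
proof -
  have "digraph_iso (with_proj (cycle_graph n)) (with_proj G)"
  proof (rule digraph_iso_pairI[OF pair_wf_digraph_cycle_graph pair_wf_digraph])
    show "bij_betw (\<lambda>i. v (int i)) (pverts (cycle_graph n)) (pverts G)"
      using induced_cycle_bij_betw[OF cyc(1,3)] cyc(2) by (simp add: cycle_graph_def)
    fix a b assume "a \<in> pverts (cycle_graph n)" "b \<in> pverts (cycle_graph n)"
    then have ab: "a < n" "b < n" by (simp_all add: cycle_graph_def)
    have "v (int i) = v (int j + 1) \<longleftrightarrow> i = Suc j mod n" if "i < n" for i j
    proof -
      have "v (int i) = v (int j + 1) \<longleftrightarrow> int i mod int n = int (Suc j) mod int n"
        using cyc(1) by (simp add: induced_cycle_def add.commute)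
      also have "\<dots> \<longleftrightarrow> i mod n = Suc j mod n" by (metis of_nat_eq_iff of_nat_mod)
      finally show ?thesis using that by simp
    qed
    then show "(a, b) \<in> parcs (cycle_graph n) \<longleftrightarrow> adj (v (int a)) (v (int b))"
      using cyc(1) ab by (simp add: parcs_cycle_graph_iff induced_cycle_def)
  qed
  then show ?thesis
    using digraph_iso_swap wf_digraph_wp_iff pair_wf_digraph_cycle_graph by metis
qed

lemma mengerian_spanning_induced_C8:
  assumes cyc: "induced_cycle 8 v" and spanning: "range v = pverts G"
  shows "mengerian (pverts G) (H3 G)"
proof -
  interpret octagon v using cyc by unfold_locales (simp add: induced_cycle_def)
  have "H3 G = windows"
  proof (intro equalityI subsetI)
    fix e assume e: "e \<in> H3 G"
    then have "e \<subseteq> range v" using H3_subset_Pow spanning by auto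
    then obtain s where "e = v ` {s..s + 3}" by (rule induced_cycle_H3_window[OF cyc e])
    then show "e \<in> windows" by (rule range_eqI)
  qed (use induced_cycle_window_H3[OF cyc] in auto)
  then show ?thesis using mengerian_windows spanning by simp
qed

lemma digraph_iso_C8_imp_mengerian:
  assumes "digraph_iso (with_proj G) (with_proj (cycle_graph 8))"
  shows "mengerian (pverts G) (H3 G)"
proof -
  obtain v where "induced_cycle 8 v" "range v = pverts G"
    using digraph_iso_cycle_graphE[OF assms] by auto
  then show ?thesis by (rule mengerian_spanning_induced_C8)
qed

lemma shortest_circuit_adj_iff:
  assumes p: "circuit p" and shortest: "\<And>q. circuit q \<Longrightarrow> length p \<le> length q"
    and ab: "a < length p" "b < length p"
  shows "adj (p ! a) (p ! b) \<longleftrightarrow> b = Suc a mod length p \<or> a = Suc b mod length p"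
proof
  have path: "is_path p" using p by (simp add: circuit_def)
  have "b = Suc a \<or> a = 0 \<and> Suc b = length p"
    if "a < b" "b < length p" "adj (p ! a) (p ! b)" for a b
  proof (cases "a + 2 \<le> b")
    case True
    then have "length p \<le> length (take (Suc b - a) (drop a p))"
      using path_chord_circuit[OF path] shortest that by blast
    then show ?thesis using that by auto
  qed (use that in auto)
  moreover assume "adj (p ! a) (p ! b)"
  moreover from this have "a \<noteq> b" by auto
  ultimately show "b = Suc a mod length p \<or> a = Suc b mod length p"
    using ab adj_commute by (cases a b rule: linorder_cases) fastforce+
next
  have succ: "adj (p ! a) (p ! (Suc a mod length p))" if "a < length p" for a
  proof (cases "Suc a < length p")
    case True
    then show ?thesis using p is_path_adj_nth by (simp add: circuit_def)
  next
    case False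
    then have "Suc a = length p" using that by simp
    moreover from this have "last p = p ! a" "hd p = p ! 0"
      by (metis diff_Suc_1 last_conv_nth length_0_conv nat.simps(3),
        metis hd_conv_nth length_0_conv nat.simps(3))
    ultimately show ?thesis using p by (simp add: circuit_def)
  qed
  assume "b = Suc a mod length p \<or> a = Suc b mod length p"
  then show "adj (p ! a) (p ! b)" using succ[OF ab(1)] succ[OF ab(2)] adj_commute by metis
qed

lemma shortest_circuit_induced_cycle:
  assumes p: "circuit p" and shortest: "\<And>q. circuit q \<Longrightarrow> length p \<le> length q"
  obtains v where "induced_cycle (int (length p)) v"
proof
  show "induced_cycle (int (length p)) (\<lambda>k. p ! nat (k mod int (length p)))"
    using p shortest_circuit_adj_iff[OF p shortest]
    by (intro induced_cycleI) (auto simp: circuit_def is_path_iff inj_on_nth)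
qed

end

subsection \<open>Connected Mengerian graphs\<close>

locale connected_pair_graph = pair_graph +
  assumes connected: "Digraph_Component.connected (with_proj G)"
begin

lemma neighbour_closed_eq_verts:
  assumes "a \<in> A" "A \<subseteq> pverts G" and closed: "\<And>u v. u \<in> A \<Longrightarrow> adj u v \<Longrightarrow> v \<in> A"
  shows "A = pverts G"
proof -
  have "strongly_connected (with_proj G)"
    using symmetric_connected_imp_strongly_connected[OF _ connected] pair_sym_arcs by simp
  then have reach: "a \<rightarrow>\<^sup>*\<^bsub>with_proj G\<^esub> v" if "v \<in> pverts G" for v
    using that assms(1,2) by (auto simp: strongly_connected_def)
  have "v \<in> A" if "v \<in> pverts G" for v
    using reach[OF that] by (induction rule: reachable_induct) (use assms(1) closed in auto)
  then show ?thesis using assms(2) by blast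
qed

lemma exit_edge:
  assumes "A \<subset> pverts G" "A \<noteq> {}"
  obtains u v where "u \<in> A" "v \<in> pverts G - A" "adj u v"
proof -
  obtain a where "a \<in> A" using assms(2) by blast
  then have "\<exists>u v. u \<in> A \<and> adj u v \<and> v \<notin> A"
    using neighbour_closed_eq_verts[of a A] assms(1) by blast
  then show thesis using that in_arcsD2 by blast
qed

end

locale mengerian_graph = connected_pair_graph +
  assumes card_verts: "5 \<le> card (pverts G)" and mengerian: "mengerian (pverts G) (H3 G)"
begin

lemma exit_edge_few:
  assumes "A \<subseteq> pverts G" "A \<noteq> {}" "card A \<le> 4"
  obtains u v where "u \<in> A" "v \<in> pverts G - A" "adj u v"
proof -
  have "A \<noteq> pverts G" using assms(3) card_verts by auto
  then show thesis using exit_edge[of A] assms(1,2) that by blast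
qed

lemma no_C4: "\<not> (distinct [a, b, c, d] \<and> adj a b \<and> adj b c \<and> adj c d \<and> adj d a)"
proof
  assume C4: "distinct [a, b, c, d] \<and> adj a b \<and> adj b c \<and> adj c d \<and> adj d a"
  then have "{a, b, c, d} \<subseteq> pverts G" "{a, b, c, d} \<noteq> {}" "card {a, b, c, d} \<le> 4"
    by (auto simp: card_insert_if dest: in_arcsD1)
  then obtain u e where u: "u \<in> {a, b, c, d}" and e: "e \<in> pverts G - {a, b, c, d}" "adj u e"
    by (rule exit_edge_few)
  from u have "\<not> mengerian (pverts G) (H3 G)"
  proof (elim insertE emptyE)
    assume "u = a"
    with C4 e show ?thesis by (intro not_mengerian_C4_pendant[of a b c d e]) auto
  next
    assume "u = b"
    with C4 e show ?thesis by (intro not_mengerian_C4_pendant[of b c d a e]) auto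
  next
    assume "u = c"
    with C4 e show ?thesis by (intro not_mengerian_C4_pendant[of c d a b e]) auto
  next
    assume "u = d"
    with C4 e show ?thesis by (intro not_mengerian_C4_pendant[of d a b c e]) auto
  qed
  then show False using mengerian by contradiction
qed

lemma triangle_exit:
  assumes "adj a b" "adj b c" "adj c a"
  obtains a' b' c' d where "adj a' b'" "adj b' c'" "adj c' a'" "adj c' d" "d \<notin> {a', b', c'}"
proof -
  have "{a, b, c} \<subseteq> pverts G" "{a, b, c} \<noteq> {}" "card {a, b, c} \<le> 4"
    using assms by (auto simp: card_insert_if dest: in_arcsD1)
  then obtain u d where "u \<in> {a, b, c}" "d \<in> pverts G - {a, b, c}" "adj u d"
    by (rule exit_edge_few)
  then show thesis
    using assms that[of b c a d] that[of c a b d] that[of a b c d] by auto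
qed

lemma triangle_other_neighbours:
  assumes triangle: "adj a b" "adj b c" "adj c a" and exit: "adj c d" "d \<notin> {a, b, c}" and "adj a v"
  shows "v \<in> {b, c}"
proof (rule ccontr)
  assume v: "v \<notin> {b, c}"
  have distinct: "distinct [a, b, c]" "a \<noteq> v" using triangle assms(6) by auto
  have "v \<noteq> d"
    using no_C4[of c d a b] triangle exit assms(6) distinct adj_commute by auto
  then show False
    using not_mengerian_bull[of c a b d v] mengerian triangle exit assms(6)
      distinct v adj_commute by auto
qed

lemma triangle_imp_star_with_edge_at:
  assumes triangle: "adj a b" "adj b c" "adj c a" and exit: "adj c d" "d \<notin> {a, b, c}"
  shows "star_with_edge_at c a b"
proof -
  have a: "v \<in> {b, c}" if "adj a v" for v
    using triangle_other_neighbours[OF triangle exit that] .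
  have b: "v \<in> {a, c}" if "adj b v" for v
    using triangle_other_neighbours[of b a c d v] triangle exit that adj_commute by auto
  have far: "v = c" if "adj c u" "u \<notin> {a, b}" "adj u v" for u v
  proof (rule ccontr)
    assume "v \<noteq> c"
    moreover have "v \<noteq> a" "v \<noteq> b" using a[of u] b[of u] that adj_commute by auto
    ultimately have "distinct [a, b, c, u, v]" using triangle that by auto
    then show False
      using not_mengerian_triangle_tail[of a b c u v] mengerian triangle that by blast
  qed
  have verts: "insert c {v. adj c v} = pverts G"
  proof (rule neighbour_closed_eq_verts[of c])
    show "insert c {v. adj c v} \<subseteq> pverts G" using triangle by (auto dest: in_arcsD1 in_arcsD2)
    fix u v assume "u \<in> insert c {v. adj c v}" "adj u v"
    then show "v \<in> insert c {v. adj c v}"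
      using a[of v] b[of v] far[of u v] triangle adj_commute by (cases "u = a"; cases "u = b") auto
  qed simp
  have "parcs G = {(a, b), (b, a)} \<union> {c} \<times> (pverts G - {c}) \<union> (pverts G - {c}) \<times> {c}"
  proof (intro subset_antisym subrelI)
    fix u v assume uv: "adj u v"
    then have V: "u \<noteq> v" "u \<in> pverts G" "v \<in> pverts G" by (auto dest: in_arcsD1 in_arcsD2)
    have "(u, v) \<in> {(a, b), (b, a)}" if "u \<noteq> c" "v \<noteq> c"
    proof -
      have "adj c u" using V(2) that(1) verts by blast
      then have "u \<in> {a, b}" using far uv that(2) by blast
      then show ?thesis using a b uv that(2) by blast
    qed
    then show "(u, v) \<in> {(a, b), (b, a)} \<union> {c} \<times> (pverts G - {c}) \<union> (pverts G - {c}) \<times> {c}"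
      using V by blast
  qed (use verts triangle adj_commute in auto)
  moreover have "distinct [a, b, c]" "{a, b, c} \<subseteq> pverts G"
    using triangle by (auto dest: in_arcsD1)
  ultimately show ?thesis by (simp add: star_with_edge_at_def)
qed

lemma triangle_imp_star_with_extra_edge:
  assumes "adj a b" "adj b c" "adj c a"
  shows "star_with_extra_edge G"
proof -
  obtain a' b' c' d where "adj a' b'" "adj b' c'" "adj c' a'" "adj c' d" "d \<notin> {a', b', c'}"
    by (rule triangle_exit[OF assms])
  then show ?thesis by (intro star_with_extra_edgeI triangle_imp_star_with_edge_at)
qed

lemma induced_cycle_length:
  assumes cyc: "induced_cycle n v" "5 \<le> n"
  shows "n = 8"
proof -
  have "4 dvd n" using not_mengerian_induced_cycle_not_dvd_4[OF cyc] mengerian by blast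
  moreover have "n < 12" using not_mengerian_induced_cycle_dvd_4[OF cyc(1) \<open>4 dvd n\<close>] mengerian
    by fastforce
  ultimately show ?thesis using cyc(2) by (auto elim!: dvdE)
qed

lemma induced_C8_spanning:
  assumes cyc: "induced_cycle 8 v"
  shows "range v = pverts G"
proof (rule ccontr)
  assume "range v \<noteq> pverts G"
  then have "range v \<subset> pverts G" using induced_cycle_range[OF cyc] by blast
  then obtain w z where w: "w \<in> range v" "z \<in> pverts G - range v" "adj w z"
    by (rule exit_edge) auto
  then obtain i where z: "z \<notin> range v" "adj (v i) z" by blast
  have "\<not> mengerian (pverts G) (H3 G)"
  proof (rule not_mengerian_spider[of "v (i - 2)" "v (i - 1)" "v i" "v (i + 1)" "v (i + 2)" z])
    show "distinct [v (i - 2), v (i - 1), v i, v (i + 1), v (i + 2), z]"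
      using z(1) induced_cycle_neq[OF cyc] by auto
  qed (use z(2) in \<open>simp_all add: induced_cycle_adj_iff[OF cyc]\<close>)
  then show False using mengerian by contradiction
qed

lemma circuit_imp_C8_or_star_with_extra_edge:
  assumes "circuit p"
  shows "digraph_iso (with_proj G) (with_proj (cycle_graph 8)) \<or> star_with_extra_edge G"
proof -
  obtain p where p: "circuit p" and shortest: "\<And>q. circuit q \<Longrightarrow> length p \<le> length q"
    using assms ex_has_least_nat[of circuit _ length] by blast
  have circuit: "3 \<le> length p" "is_path p" "adj (last p) (hd p)" using p by (auto simp: circuit_def)
  consider (triangle) "length p = 3" | (square) "length p = 4" | (long) "5 \<le> length p"
    using circuit(1) by linarith
  then show ?thesis
  proof cases
    case triangle
    then obtain a b c where "p = [a, b, c]" by (auto simp: eval_nat_numeral length_Suc_conv)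
    then show ?thesis
      using triangle_imp_star_with_extra_edge[of a b c] circuit by (auto simp: is_path_iff)
  next
    case square
    then obtain a b c d where "p = [a, b, c, d]" by (auto simp: eval_nat_numeral length_Suc_conv)
    then show ?thesis using no_C4[of a b c d] circuit by (auto simp: is_path_iff)
  next
    case long
    obtain v where v: "induced_cycle (int (length p)) v"
      using shortest_circuit_induced_cycle[OF p shortest] .
    moreover from this have "int (length p) = 8" using long by (intro induced_cycle_length) auto
    ultimately have "induced_cycle (int 8) v" "range v = pverts G"
      using induced_C8_spanning by simp_all
    then show ?thesis using digraph_iso_cycle_graphI[of 8] by auto
  qed
qed

end

subsection \<open>Longest paths in trees\<close>

context pair_graph
begin

abbreviation supports :: "'a set" where
  "supports \<equiv> {v \<in> pverts G. \<exists>l. leaf G l \<and> adj v l}"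

lemma leaf_iff: "leaf G l \<longleftrightarrow> (\<exists>s. \<forall>u. adj l u \<longleftrightarrow> u = s)"
proof -
  have "out_arcs (with_proj G) l = Pair l ` {u. adj l u}" by (auto simp: out_arcs_def)
  then have "out_degree (with_proj G) l = card {u. adj l u}"
    by (simp add: out_degree_def card_image inj_on_def)
  moreover have "card {u. adj l u} = 1 \<longleftrightarrow> (\<exists>s. \<forall>u. adj l u \<longleftrightarrow> u = s)"
    by (auto simp: card_1_singleton_iff)
  moreover have "l \<in> pverts G" if "\<forall>u. adj l u \<longleftrightarrow> u = s" for s
    using that in_arcsD1[of l s] by blast
  ultimately show ?thesis by (auto simp: leaf_def)
qed

lemma supports_iff: "s \<in> supports \<longleftrightarrow> (\<exists>l. \<forall>u. adj l u \<longleftrightarrow> u = s)"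
proof
  assume "s \<in> supports"
  then obtain l s' where "adj s l" "\<forall>u. adj l u \<longleftrightarrow> u = s'" by (auto simp: leaf_iff)
  then show "\<exists>l. \<forall>u. adj l u \<longleftrightarrow> u = s" using adj_commute by metis
next
  assume "\<exists>l. \<forall>u. adj l u \<longleftrightarrow> u = s"
  then obtain l where l: "\<forall>u. adj l u \<longleftrightarrow> u = s" by blast
  then have "adj s l" using adj_commute by blast
  then show "s \<in> supports" using l in_arcsD1 leaf_iff by blast
qed

definition twins :: "'a \<Rightarrow> 'a \<Rightarrow> bool" where
  "twins u v \<longleftrightarrow> (\<forall>w. adj u w \<longleftrightarrow> adj v w)"

definition longest_path :: "'a list \<Rightarrow> bool" where
  "longest_path p \<longleftrightarrow> is_path p \<and> (\<forall>q. is_path q \<longrightarrow> length q \<le> length p)"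

lemma longest_path_rev: "longest_path (rev p) \<longleftrightarrow> longest_path p"
  by (simp add: longest_path_def is_path_rev)

lemma is_path_snoc: "p \<noteq> [] \<Longrightarrow> is_path (p @ [a]) \<longleftrightarrow> is_path p \<and> adj (last p) a \<and> a \<notin> set p"
  using is_path_Cons[of "rev p" a] is_path_rev[of "a # rev p"] is_path_rev[of p]
  by (auto simp: hd_rev adj_commute)

end

locale tree_graph = connected_pair_graph +
  assumes acyclic: "\<not> circuit p"
begin

lemma is_path_Cons_acyclic:
  assumes p: "is_path (b # p)" and ab: "adj a b" and turn: "p \<noteq> [] \<Longrightarrow> a \<noteq> hd p"
  shows "is_path (a # b # p)"
proof -
  have "a \<notin> set (b # p)"
  proof
    assume "a \<in> set (b # p)"
    then obtain j where j: "j < length (b # p)" "a = (b # p) ! j" by (metis in_set_conv_nth)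
    have "j \<noteq> 0" using j(2) ab by (cases j) auto
    moreover have "j \<noteq> 1" using j turn by (cases p) auto
    ultimately have "2 \<le> j" by linarith
    moreover have "last (take (Suc j) (b # p)) = a"
      by (simp only: take_Suc_conv_app_nth[OF j(1)] last_snoc j(2))
    ultimately have "circuit (take (Suc j) (b # p))"
      using is_path_take[OF p, of "Suc j"] ab j(1) by (simp add: circuit_def)
    then show False using acyclic by contradiction
  qed
  then show ?thesis using p ab by (simp add: is_path_Cons)
qed

lemma is_path_glue:
  assumes "is_path (q @ [x, y])" "is_path (x # y # r)"
  shows "is_path (q @ x # y # r)"
  using assms(1)
proof (induction q)
  case (Cons c q)
  then have c: "adj c (hd (q @ [x, y]))" "c \<notin> set (q @ [x, y])" and "is_path (q @ [x, y])"
    using is_path_Cons[of "q @ [x, y]" c] by simp_all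
  then have "is_path (q @ x # y # r)" using Cons.IH by simp
  then show ?case using c by (cases q; cases "tl q") (auto intro: is_path_Cons_acyclic)
qed (use assms(2) in simp)

lemma is_path_adj_iff:
  assumes p: "is_path p" and "i < length p" "j < length p"
  shows "adj (p ! i) (p ! j) \<longleftrightarrow> j = Suc i \<or> i = Suc j"
proof
  assume adj: "adj (p ! i) (p ! j)"
  have chord: "\<not> adj (p ! i) (p ! j)" if "i + 2 \<le> j" "j < length p" for i j
    using path_chord_circuit[OF p that] acyclic by blast
  have "i \<noteq> j" using adj by auto
  then show "j = Suc i \<or> i = Suc j"
    using chord[of i j] chord[of j i] adj adj_commute assms(2,3) by fastforce
qed (use is_path_adj_nth[OF p] assms adj_commute in auto)

lemma path_to_support:
  assumes "adj x y"
  obtains r s where "is_path (x # y # r)" "s \<in> supports" "s \<in> set (x # y # r)"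
proof -
  define P where "P r \<longleftrightarrow> is_path (x # y # r)" for r
  have "P []" using assms by (simp add: P_def is_path_edge)
  moreover have "length r < Suc (card (pverts G))" if "P r" for r
    using length_path_le[of "x # y # r"] that by (simp add: P_def)
  ultimately obtain r where r: "P r" and longest: "\<And>r'. P r' \<Longrightarrow> length r' \<le> length r"
    using ex_has_greatest_nat[of P "[]" length "Suc (card (pverts G))"] by (auto simp: less_imp_le)
  obtain q s l where q: "x # y # r = q @ [s, l]"
    by (metis append.assoc append_Cons append_Nil append_butlast_last_id butlast.simps(2)
        list.distinct(1))
  have path: "is_path (q @ [s, l])" using r by (simp add: P_def q)
  then have "adj s l" by (simp add: is_path_iff successively_append_iff)
  have "u = s" if "adj l u" for u
  proof (rule ccontr)
    assume "u \<noteq> s"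
    then have "is_path (s # l # [u])"
      using \<open>adj s l\<close> that by (auto simp: is_path_Cons is_path_edge)
    then have "is_path (q @ s # l # [u])" by (rule is_path_glue[OF path])
    moreover have "q @ s # l # [u] = x # y # (r @ [u])"
      using q by (metis append.assoc append_Cons append_Nil)
    ultimately have "P (r @ [u])" by (simp add: P_def)
    then show False using longest by fastforce
  qed
  then have "\<forall>u. adj l u \<longleftrightarrow> u = s" using \<open>adj s l\<close> adj_commute by blast
  then have "s \<in> supports" unfolding supports_iff by blast
  moreover have "s \<in> set (x # y # r)" by (simp add: q)
  ultimately show thesis using that r by (simp add: P_def)
qed

lemma is_path_branch:
  assumes p: "is_path p" and "i < length p" "v \<notin> set p" and r: "is_path (p ! i # v # r)"
  shows "is_path (take i p @ p ! i # v # r)"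
proof -
  have "adj (p ! i) v" using r by (simp add: is_path_Cons)
  moreover have take: "take (Suc i) p = take i p @ [p ! i]"
    using assms(2) by (rule take_Suc_conv_app_nth)
  moreover from this have "last (take (Suc i) p) = p ! i" by simp
  ultimately have "is_path (take (Suc i) p @ [v])"
    using is_path_take[OF p, of "Suc i"] assms(3)
    by (subst is_path_snoc) (auto simp del: take_Suc dest: in_set_takeD)
  then show ?thesis using is_path_glue[of "take i p" "p ! i" v r] r by (simp add: take)
qed

lemma is_path_branch_rev:
  assumes p: "is_path p" and i: "i < length p" and "v \<notin> set p" "is_path (p ! i # v # r)"
  shows "is_path (rev (drop (Suc i) p) @ p ! i # v # r)"
proof -
  have "rev p ! (length p - Suc i) = p ! i" "length p - Suc i < length (rev p)"
    using i by (simp_all add: rev_nth)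
  then show ?thesis
    using is_path_branch[of "rev p" "length p - Suc i" v r] assms
    by (simp add: is_path_rev take_rev)
qed

lemma longest_path_branch:
  assumes p: "longest_path p" and "i < length p" "v \<notin> set p" "is_path (p ! i # v # r)"
  shows "i + 2 + length r \<le> length p" and "Suc (length r) \<le> i"
proof -
  have path: "is_path p" and longest: "\<And>q. is_path q \<Longrightarrow> length q \<le> length p"
    using p by (auto simp: longest_path_def)
  show "i + 2 + length r \<le> length p"
    using longest[OF is_path_branch[OF path assms(2-4)]] assms(2) by simp
  show "Suc (length r) \<le> i"
    using longest[OF is_path_branch_rev[OF path assms(2-4)]] assms(2) by simp
qed

lemma longest_path_exists:
  assumes "3 \<le> card (pverts G)"
  obtains p where "longest_path p" "3 \<le> length p"
proof -
  obtain u where "u \<in> pverts G" using assms by fastforce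
  then have "is_path [u]" by (simp add: is_path_iff)
  then obtain p where p: "longest_path p"
    using ex_has_greatest_nat[of is_path "[u]" length "Suc (card (pverts G))"] length_path_le
    by (auto simp: longest_path_def less_Suc_eq_le)
  have "3 \<le> length p"
  proof (cases "set p = pverts G")
    case True
    then show ?thesis using p assms by (metis distinct_card is_path_iff longest_path_def)
  next
    case False
    then have "set p \<subset> pverts G" "set p \<noteq> {}" using p by (auto simp: longest_path_def is_path_iff)
    then obtain w v where "w \<in> set p" "v \<in> pverts G - set p" "adj w v" by (rule exit_edge)
    then obtain i where "i < length p" "v \<notin> set p" "adj (p ! i) v" by (auto simp: in_set_conv_nth)
    then show ?thesis
      using longest_path_branch[OF p, of i v "[]"] by (auto simp: is_path_edge)
  qed
  then show thesis using p that by blast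
qed

lemma longest_path_hd_neighbour:
  assumes p: "longest_path p" "2 \<le> length p"
  shows "adj (p ! 0) u \<longleftrightarrow> u = p ! 1"
proof
  have path: "is_path p" and nonempty: "0 < length p" using p by (auto simp: longest_path_def)
  assume adj: "adj (p ! 0) u"
  have "u \<in> set p"
  proof (rule ccontr)
    assume off: "u \<notin> set p"
    have "is_path [p ! 0, u]" using adj unfolding is_path_edge .
    from longest_path_branch(2)[OF p(1) nonempty off this] show False by simp
  qed
  then obtain j where "j < length p" "u = p ! j" by (auto simp: in_set_conv_nth)
  then show "u = p ! 1" using adj is_path_adj_iff[OF path nonempty, of j] by auto
qed (use p is_path_adj_nth[of p 0] in \<open>auto simp: longest_path_def\<close>)

lemma longest_path_last_neighbour:
  assumes p: "longest_path p" "2 \<le> length p"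
  shows "adj (p ! (length p - 1)) u \<longleftrightarrow> u = p ! (length p - 2)"
proof -
  have "0 < length p" "1 < length p" using p(2) by auto
  then have "rev p ! 0 = p ! (length p - 1)" "rev p ! 1 = p ! (length p - 2)"
    by (simp_all add: rev_nth numeral_2_eq_2)
  moreover have "adj (rev p ! 0) u \<longleftrightarrow> u = rev p ! 1"
    by (rule longest_path_hd_neighbour) (use p in \<open>simp_all add: longest_path_rev\<close>)
  ultimately show ?thesis by simp
qed

lemma longest_path_ends_supports:
  assumes "longest_path p" "2 \<le> length p"
  shows "p ! 1 \<in> supports" and "p ! (length p - 2) \<in> supports"
  unfolding supports_iff
  using longest_path_hd_neighbour[OF assms] longest_path_last_neighbour[OF assms] by blast+

subsection \<open>Paths with double stars\<close>

text \<open>A path with double stars arises from a path by duplicating its two ends.\<close>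

definition duplicates_ends :: "'a list \<Rightarrow> bool" where
  "duplicates_ends p \<longleftrightarrow> (\<forall>v\<in>pverts G - set p. twins v (p ! 0) \<or> twins v (p ! (length p - 1)))"

lemma off_path_twin:
  assumes p: "longest_path p" "2 \<le> length p" and i: "i = 1 \<or> i = length p - 2"
    and w: "w \<notin> set p" "adj (p ! i) w"
  shows "twins w (p ! 0) \<or> twins w (p ! (length p - 1))"
proof -
  have "i < length p" using i p(2) by auto
  have "u = p ! i" if "adj w u" for u
  proof (rule ccontr)
    assume "u \<noteq> p ! i"
    then have "is_path (p ! i # w # [u])"
      using w(2) that by (auto simp: is_path_Cons is_path_edge)
    from longest_path_branch[OF p(1) \<open>i < length p\<close> w(1) this] show False
      using i by auto
  qed
  then have "adj w u \<longleftrightarrow> u = p ! i" for u using w(2) adj_commute by blast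
  then have "(\<forall>u. adj w u \<longleftrightarrow> u = p ! 1) \<or> (\<forall>u. adj w u \<longleftrightarrow> u = p ! (length p - 2))"
    using i by auto
  then show ?thesis
    unfolding twins_def longest_path_hd_neighbour[OF p] longest_path_last_neighbour[OF p] .
qed

lemma duplicates_endsI:
  assumes p: "longest_path p" "2 \<le> length p"
    and inner: "\<And>i v. 2 \<le> i \<Longrightarrow> i + 2 < length p \<Longrightarrow> adj (p ! i) v \<Longrightarrow> v \<in> set p"
  shows "duplicates_ends p"
proof -
  let ?A = "set p \<union> {v\<in>pverts G. twins v (p ! 0) \<or> twins v (p ! (length p - 1))}"
  have on_path: "p ! 0 \<in> set p" "p ! 1 \<in> set p" "p ! (length p - 2) \<in> set p"
    using p(2) by (auto intro!: nth_mem)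
  have "?A = pverts G"
  proof (rule neighbour_closed_eq_verts)
    show "p ! 0 \<in> ?A" using on_path by simp
    show "?A \<subseteq> pverts G" using p(1) by (auto simp: longest_path_def is_path_iff)
    fix u w assume u: "u \<in> ?A" "adj u w"
    then have "w = p ! 1 \<or> w = p ! (length p - 2) \<or> u \<in> set p"
      using longest_path_hd_neighbour[OF p] longest_path_last_neighbour[OF p]
      by (auto simp: twins_def)
    then consider (on) "w \<in> set p" | (off) "w \<notin> set p" "u \<in> set p"
      using on_path by blast
    then show "w \<in> ?A"
    proof cases
      case off
      then obtain i where i: "i < length p" "adj (p ! i) w"
        using u(2) by (auto simp: in_set_conv_nth)
      then have "1 \<le> i" "i + 2 \<le> length p"
        using longest_path_branch[OF p(1) i(1) off(1), of "[]"] by (simp_all add: is_path_edge)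
      then have "i = 1 \<or> i = length p - 2" using inner[OF _ _ i(2)] off(1) by fastforce
      then show ?thesis
        using off_path_twin[OF p _ off(1) i(2)] u(2) by (auto dest: in_arcsD2)
    qed simp
  qed
  then show ?thesis by (auto simp: duplicates_ends_def)
qed

lemma mengerian_imp_duplicates_ends:
  assumes p: "longest_path p" "3 \<le> length p" and mengerian: "mengerian (pverts G) (H3 G)"
  shows "duplicates_ends p"
proof (rule duplicates_endsI[OF p(1)], use p(2) in simp, rule ccontr)
  fix i v assume i: "2 \<le> i" "i + 2 < length p" and v: "adj (p ! i) v" "v \<notin> set p"
  have path: "is_path p" using p by (simp add: longest_path_def)
  have "\<not> mengerian (pverts G) (H3 G)"
  proof (rule not_mengerian_spider[of "p ! (i - 2)" "p ! (i - 1)" "p ! i" "p ! (i + 1)"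
        "p ! (i + 2)" v])
    have "p ! j \<noteq> v" if "j < length p" for j using v(2) that by auto
    then show "distinct [p ! (i - 2), p ! (i - 1), p ! i, p ! (i + 1), p ! (i + 2), v]"
      using i path by (auto simp: is_path_iff nth_eq_iff_index_eq)
  qed (use i v(1) in \<open>auto simp: is_path_adj_iff[OF path]\<close>)
  then show False using mengerian by contradiction
qed

lemma few_supports_imp_duplicates_ends:
  assumes p: "longest_path p" "3 \<le> length p" and few: "card supports \<le> 2"
  shows "duplicates_ends p"
proof (rule duplicates_endsI[OF p(1)], use p(2) in simp, rule ccontr)
  fix i v assume i: "2 \<le> i" "i + 2 < length p" and v: "adj (p ! i) v" "v \<notin> set p"
  have path: "is_path p" using p by (simp add: longest_path_def)
  obtain r s where r: "is_path (p ! i # v # r)" and s: "s \<in> supports" "s \<in> set (p ! i # v # r)"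
    using path_to_support[OF v(1)] .
  have "i < length p" using i by simp
  then have "distinct (take i p @ p ! i # v # r)" "distinct (rev (drop (Suc i) p) @ p ! i # v # r)"
    using is_path_branch[OF path _ v(2) r] is_path_branch_rev[OF path _ v(2) r]
    by (auto simp: is_path_iff)
  moreover have "p ! 1 \<in> set (take i p)"
    using i by (auto simp: in_set_conv_nth intro!: exI[of _ 1])
  moreover have "Suc (length p - 3) = length p - 2" using i by linarith
  then have "p ! (length p - 2) \<in> set (drop (Suc i) p)"
    using i by (auto simp: in_set_conv_nth intro!: exI[of _ "length p - 2 - Suc i"])
  ultimately have "s \<noteq> p ! 1" "s \<noteq> p ! (length p - 2)" using s(2) by auto
  moreover have "p ! 1 \<noteq> p ! (length p - 2)"
    using i path by (simp add: is_path_iff nth_eq_iff_index_eq)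
  ultimately have "card {s, p ! 1, p ! (length p - 2)} = 3" by simp
  moreover have "card {s, p ! 1, p ! (length p - 2)} \<le> card supports"
    using longest_path_ends_supports[OF p(1)] p(2) s(1) pair_finite_verts by (intro card_mono) auto
  ultimately show False using few by linarith
qed

lemma duplicates_ends_pos:
  assumes "duplicates_ends p" "p \<noteq> []"
  obtains pos where "\<And>v. v \<in> pverts G \<Longrightarrow> pos v < length p \<and> twins v (p ! pos v) \<and>
    (v = p ! pos v \<or> pos v = 0 \<or> pos v = length p - 1)"
proof -
  have "\<exists>i<length p. twins v (p ! i) \<and> (v = p ! i \<or> i = 0 \<or> i = length p - 1)"
    if v: "v \<in> pverts G" for v
  proof (cases "v \<in> set p")
    case True
    then show ?thesis by (auto simp: in_set_conv_nth twins_def)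
  next
    case False
    then have "twins v (p ! 0) \<or> twins v (p ! (length p - 1))"
      using assms(1) v by (auto simp: duplicates_ends_def)
    then show ?thesis using assms(2) by (metis diff_less length_greater_0_conv zero_less_one)
  qed
  then show thesis using that by metis
qed

lemma duplicates_ends_supports:
  assumes p: "longest_path p" "3 \<le> length p" and dup: "duplicates_ends p"
  shows "supports \<subseteq> {p ! 1, p ! (length p - 2)}"
proof
  have path: "is_path p" and len: "2 \<le> length p" using p by (simp_all add: longest_path_def)
  fix s assume "s \<in> supports"
  then obtain l where l: "adj l u \<longleftrightarrow> u = s" for u unfolding supports_iff by blast
  then have "l \<in> pverts G" using in_arcsD1[of l s] by blast
  then obtain i where i: "i < length p" "twins l (p ! i)"
    using duplicates_ends_pos[OF dup] p(2) by (metis list.size(3) not_numeral_le_zero)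
  have s: "adj (p ! i) u \<longleftrightarrow> u = s" for u using i(2) l by (simp add: twins_def)
  consider (first) "i = 0" | (last) "i = length p - 1" | (inner) "0 < i" "Suc i < length p"
    using i(1) by linarith
  then show "s \<in> {p ! 1, p ! (length p - 2)}"
  proof cases
    case first
    then show ?thesis using s longest_path_hd_neighbour[OF p(1) len] by auto
  next
    case last
    then show ?thesis using s longest_path_last_neighbour[OF p(1) len] by auto
  next
    case inner
    then have "adj (p ! i) (p ! Suc i)" "adj (p ! i) (p ! (i - 1))"
      using is_path_adj_iff[OF path i(1)] by auto
    then have "p ! Suc i = p ! (i - 1)" unfolding s by simp
    then show ?thesis using path inner by (simp add: is_path_iff nth_eq_iff_index_eq)
  qed
qed

lemma duplicates_ends_imp_mengerian:
  assumes p: "longest_path p" "3 \<le> length p" and dup: "duplicates_ends p"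
  shows "mengerian (pverts G) (H3 G)"
proof -
  have path: "is_path p" and len: "2 \<le> length p" and "p \<noteq> []"
    using p by (auto simp: longest_path_def)
  then obtain pos where pos: "\<And>v. v \<in> pverts G \<Longrightarrow> pos v < length p"
    and twin: "\<And>v w. v \<in> pverts G \<Longrightarrow> adj v w \<longleftrightarrow> adj (p ! pos v) w"
    and ends: "\<And>v. v \<in> pverts G \<Longrightarrow> v = p ! pos v \<or> pos v = 0 \<or> pos v = length p - 1"
    using duplicates_ends_pos[OF dup] unfolding twins_def by metis
  have "H3 G = layer_transversals 4 (pverts G) pos"
  proof (rule H3_layered)
    fix u v assume uv: "u \<in> pverts G" "v \<in> pverts G"
    have "adj u v \<longleftrightarrow> adj (p ! pos u) (p ! pos v)"
      using twin[OF uv(1)] twin[OF uv(2)] adj_commute by metis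
    then show "adj u v \<longleftrightarrow> pos u = Suc (pos v) \<or> pos v = Suc (pos u)"
      using is_path_adj_iff[OF path] pos uv by auto
    fix a b assume "u \<noteq> v" "pos u = pos v" and adj: "adj u a" "adj u b"
    then have "pos u = 0 \<or> pos u = length p - 1" using ends uv by metis
    then show "a = b"
      using adj longest_path_hd_neighbour[OF p(1) len] longest_path_last_neighbour[OF p(1) len]
      unfolding twin[OF uv(1)] by auto
  qed
  then show ?thesis using mengerian_layer_transversals[OF pair_finite_verts] by simp
qed

lemma mengerian_iff_few_supports:
  assumes "3 \<le> card (pverts G)"
  shows "mengerian (pverts G) (H3 G) \<longleftrightarrow> card supports \<le> 2"
proof -
  obtain p where p: "longest_path p" "3 \<le> length p" using longest_path_exists[OF assms] .
  show ?thesis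
  proof
    assume "mengerian (pverts G) (H3 G)"
    then have "supports \<subseteq> {p ! 1, p ! (length p - 2)}"
      by (intro duplicates_ends_supports[OF p] mengerian_imp_duplicates_ends[OF p])
    then have "card supports \<le> card {p ! 1, p ! (length p - 2)}" by (intro card_mono) auto
    also have "\<dots> \<le> 2" by (simp add: card_insert_if)
    finally show "card supports \<le> 2" .
  next
    assume "card supports \<le> 2"
    then show "mengerian (pverts G) (H3 G)"
      by (intro duplicates_ends_imp_mengerian[OF p] few_supports_imp_duplicates_ends[OF p])
  qed
qed

end

theorem theorem3p13:
  fixes G :: "'a pair_pre_digraph"
  assumes "pair_graph G"
    and "Digraph_Component.connected (with_proj G)"
    and "card (pverts G) \<ge> 4"
  shows "mengerian (pverts G) (H3 G) \<longleftrightarrow>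
           card (pverts G) = 4 \<or>
           digraph_iso (with_proj G) (with_proj (cycle_graph 8)) \<or>
           path_with_double_stars G \<or>
           star_with_extra_edge G"
proof -
  interpret connected_pair_graph G
    using assms(1,2) by (intro connected_pair_graph.intro connected_pair_graph_axioms.intro)
  note sufficient = mengerian_four_vertices digraph_iso_C8_imp_mengerian
    star_with_extra_edge_imp_mengerian
  show ?thesis
  proof (cases "\<exists>p. circuit p")
    case True
    then have "\<not> path_with_double_stars G"
      by (simp add: path_with_double_stars_def undirected_tree_iff)
    moreover have "digraph_iso (with_proj G) (with_proj (cycle_graph 8)) \<or> star_with_extra_edge G"
      if "mengerian (pverts G) (H3 G)" "card (pverts G) \<noteq> 4"
    proof -
      interpret mengerian_graph G using that assms(3) by unfold_locales auto
      show ?thesis using True circuit_imp_C8_or_star_with_extra_edge by blast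
    qed
    ultimately show ?thesis using sufficient by blast
  next
    case False
    then interpret tree_graph G by unfold_locales blast
    have "path_with_double_stars G \<longleftrightarrow> mengerian (pverts G) (H3 G)"
      using False connected mengerian_iff_few_supports assms(3)
      by (simp add: path_with_double_stars_def undirected_tree_iff)
    then show ?thesis using sufficient by blast
  qed
qed

end
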